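(* Let $g$ be a $g$-function on a finite alphabet $A$, with set of discontinuities $\mathcal{D}_g\subset\mathcal{X}^-$. Suppose that there exist a past $\underline x\in\mathcal{X}^-$ and a subsequential weak limit $\bar\mu^{\underline x}$ of the sequence $(\bar\mu^{\underline x,-k})_{k\geq 1}$ such that $\bar\mu^{\underline x}(\mathcal{D}_g)=0$. Then $\bar\mu^{\underline x}\in\mathcal{M}_T(g)$; in particular $\mathcal{M}_T(g)\neq\emptyset$.
   Context: $A$ is a finite (nonempty) alphabet with the discrete topology, $\mathcal{X}=A^{\mathbb{Z}}$, $\mathcal{X}^-=A^{\{\ldots,-2,-1\}}$ (pasts), $\mathcal{X}^{\le 0}=A^{\{\ldots,-1,0\}}$, all with product topologies; $\mathcal{F}$ is the product $\sigma$-algebra on $\mathcal{X}$, $\mathcal{F}^{[m,n]}$ the sub-$\sigma$-algebra generated by coordinates $m,\ldots,n$, $\mathcal{F}^{\le 0}$ and $\mathcal{F}^-$ those generated by the coordinates of index $\le 0$ and $\le -1$. For $x\in\mathcal{X}$, $\underline x=x_{-\infty}^{-1}=\ldots x_{-2}x_{-1}$. $T$ is the shift $(Tx)_n=x_{n+1}$. $[a]_0=\{x: x_0=a\}$, and for a finite string $a_m^n$, $\mu(a_m^n)=\mu(\{x:x_m^n=a_m^n\})$. A $g$-function is an $\mathcal{F}^{\le 0}$-measurable $g:\mathcal{X}^{\le 0}\to[0,1]$ with $\sum_{a\in A}g(\underline x a)=1$ for all $\underline x\in\mathcal{X}^-$, where $\underline x a$ is concatenation. By shifting indices, $g$ is applied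 to any left-infinite sequence $x_{-\infty}^i$. For a left-infinite sequence $\underline x$ followed by a string $a_1\ldots a_n$, $g_n(\underline x a_1\ldots a_n)=\prod_{i=1}^n g(\underline x a_1\ldots a_i)$. $g$ is continuous at $\underline x\in\mathcal{X}^-$ if $g(\underline x^{(k)}a)\to g(\underline x a)$ for every $a\in A$ and every sequence $\underline x^{(k)}\to\underline x$ in $\mathcal{X}^-$; $\mathcal{D}_g\subset\mathcal{X}^-$ is the set of pasts at which $g$ is not continuous. For a measure $\mu$ on $\mathcal{X}$, $\mu(\mathcal{D}_g)$ means $\mu(\{y\in\mathcal{X}:\underline y\in\mathcal{D}_g\})$. $\mathcal{M}_T(g)$ is the set of shift-invariant Borel probability measures $\mu$ on $\mathcal{X}$ compatible with $g$, i.e. such that for every $a\in A$, $\mathbb{E}_\mu(\mathbf 1_{[a]_0}\mid\mathcal{F}^-)(x)=g(\underline x a)$ for $\mu$-a.e. $x$. For $\underline x\in\mathcal{X}^-$, $\mu^{\underline x}$ is the unique probability measure on $\mathcal{X}$ with $\mu^{\underline x}(C)=\mathbf 1_C(\underline x)$ for $C\in\mathcal{F}^-$ and $\mu^{\underline x}(a_0^{n-1})=g_n(\underline x a_0^{n-1})$ for all $n\ge1$, $a_0^{n-1}\in A^n$. Put $\mu^{\underline x,-i}=\mu^{\underline x}\circ T^{-i}$ for $i\ge 0$ and $\bar\mu^{\underline x,-k}=\frac1k\sum_{i=0}^{k-1}\mu^{\underline x,-i}$ for $k\ge1$. By compactness this sequence has weakly convergent subsequences; $\bar\mu^{\underline x}$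 denotes such a subsequential limit. *)

theory Defs
  imports "HOL-Probability.Probability"
begin

text \<open>
  The alphabet is a type of sort \<open>{finite, discrete_topology}\<close>, and bi-infinite sequences are
  functions \<open>int \<Rightarrow> 'a\<close>. A left-infinite sequence is a function \<open>nat \<Rightarrow> 'a\<close> read from right to
  left: \<open>w k\<close> is its \<open>k\<close>-th symbol counted from the right end. This forgets the position of the
  right end, so that one type serves the pasts (ending at index \<open>-1\<close>), the domain of a
  \<open>g\<close>-function (ending at index \<open>0\<close>) and all shifted versions. Both function types carry
  the product topology.
\<close>

type_synonym 'a left_seq = "nat \<Rightarrow> 'a"

definition past :: "(int \<Rightarrow> 'a) \<Rightarrow> 'a left_seq" where
  "past x = (\<lambda>k. x (- 1 - int k))"

definition snoc :: "'a left_seq \<Rightarrow> 'a \<Rightarrow> 'a left_seq" where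
  "snoc w a = case_nat a w"

definition conc :: "'a left_seq \<Rightarrow> 'a list \<Rightarrow> 'a left_seq" where
  "conc w as = foldl snoc w as"

definition shift :: "(int \<Rightarrow> 'a) \<Rightarrow> (int \<Rightarrow> 'a)" where
  "shift x = (\<lambda>n. x (n + 1))"

definition seq_algebra :: "('i \<Rightarrow> 'a) measure" where
  "seq_algebra = PiM UNIV (\<lambda>_. count_space UNIV)"

definition past_algebra :: "(int \<Rightarrow> 'a) measure" where
  "past_algebra = sigma UNIV {{x. x i = a} | i a. i \<le> - 1}"

definition cylinder :: "int \<Rightarrow> 'a list \<Rightarrow> (int \<Rightarrow> 'a) set" where
  "cylinder m as = {x. \<forall>i < length as. x (m + int i) = as ! i}"

definition g_function :: "('a::finite left_seq \<Rightarrow> real) \<Rightarrow> bool" where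
  "g_function g \<longleftrightarrow>
     g \<in> borel_measurable seq_algebra \<and>
     (\<forall>w. 0 \<le> g w \<and> g w \<le> 1) \<and>
     (\<forall>w. (\<Sum>a\<in>UNIV. g (snoc w a)) = 1)"

definition g_string :: "('a left_seq \<Rightarrow> real) \<Rightarrow> 'a left_seq \<Rightarrow> 'a list \<Rightarrow> real" where
  "g_string g w as = (\<Prod>i = 1..length as. g (conc w (take i as)))"

definition g_continuous_at ::
    "('a::topological_space left_seq \<Rightarrow> real) \<Rightarrow> 'a left_seq \<Rightarrow> bool" where
  "g_continuous_at g w \<longleftrightarrow>
     (\<forall>a. \<forall>ws. ws \<longlonglongrightarrow> w \<longrightarrow> (\<lambda>k. g (snoc (ws k) a)) \<longlonglongrightarrow> g (snoc w a))"

text \<open>Over a finite alphabet this set is a countable union of closed sets, whatever \<open>g\<close> is, so that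
  the measure of its preimage under \<^const>\<open>past\<close> is meaningful.\<close>

definition discontinuities :: "('a::topological_space left_seq \<Rightarrow> real) \<Rightarrow> 'a left_seq set" where
  "discontinuities g = {w. \<not> g_continuous_at g w}"

definition compatible :: "('a left_seq \<Rightarrow> real) \<Rightarrow> (int \<Rightarrow> 'a) measure \<Rightarrow> bool" where
  "compatible g M \<longleftrightarrow>
     (\<forall>a. AE x in M. real_cond_exp M past_algebra (indicator {y. y 0 = a}) x = g (snoc (past x) a))"

definition invariant_g_measures :: "('a left_seq \<Rightarrow> real) \<Rightarrow> (int \<Rightarrow> 'a) measure set" where
  "invariant_g_measures g =
     {M. prob_space M \<and> sets M = sets seq_algebra \<and> distr M seq_algebra shift = M \<and> compatible g M}"

text \<open>In the second condition the indicator of \<open>C\<close> depends only on the past of its argument.\<close>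

definition past_measure :: "('a left_seq \<Rightarrow> real) \<Rightarrow> 'a left_seq \<Rightarrow> (int \<Rightarrow> 'a) measure" where
  "past_measure g w =
     (THE M. prob_space M \<and> sets M = sets seq_algebra \<and>
        (\<forall>C \<in> sets past_algebra. \<forall>y. past y = w \<longrightarrow> measure M C = indicator C y) \<and>
        (\<forall>as. as \<noteq> [] \<longrightarrow> measure M (cylinder 0 as) = g_string g w as))"

definition shifted_past_measure ::
    "('a left_seq \<Rightarrow> real) \<Rightarrow> 'a left_seq \<Rightarrow> nat \<Rightarrow> (int \<Rightarrow> 'a) measure" where
  "shifted_past_measure g w i = distr (past_measure g w) seq_algebra (shift ^^ i)"

definition averaged_past_measure ::
    "('a left_seq \<Rightarrow> real) \<Rightarrow> 'a left_seq \<Rightarrow> nat \<Rightarrow> (int \<Rightarrow> 'a) measure" where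
  "averaged_past_measure g w k =
     measure_of UNIV (sets seq_algebra)
       (\<lambda>C. ennreal (1 / real k) * (\<Sum>i<k. emeasure (shifted_past_measure g w i) C))"

definition weakly_converges ::
    "(nat \<Rightarrow> (int \<Rightarrow> 'a::topological_space) measure) \<Rightarrow> (int \<Rightarrow> 'a) measure \<Rightarrow> bool" where
  "weakly_converges N M \<longleftrightarrow>
     (\<forall>f :: (int \<Rightarrow> 'a) \<Rightarrow> real. continuous_on UNIV f \<and> bounded (range f) \<longrightarrow>
        (\<lambda>j. \<integral>x. f x \<partial>N j) \<longlonglongrightarrow> (\<integral>x. f x \<partial>M))"

definition subsequential_weak_limit ::
    "(nat \<Rightarrow> (int \<Rightarrow> 'a::topological_space) measure) \<Rightarrow> (int \<Rightarrow> 'a) measure \<Rightarrow> bool" where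
  "subsequential_weak_limit N M \<longleftrightarrow>
     prob_space M \<and> sets M = sets seq_algebra \<and>
     (\<exists>r. strict_mono r \<and> (\<forall>j. 1 \<le> r j) \<and> weakly_converges (\<lambda>j. N (r j)) M)"

text \<open>The product sigma-algebra is the Borel algebra of the product topology. The library's
  \<open>sets_PiM_equal_borel\<close> does not apply, as \<open>discrete_topology\<close> is not a subclass of
  \<open>second_countable_topology\<close>.\<close>

lemma sets_seq_algebra_eq_borel:
  "sets (seq_algebra :: ('i::countable \<Rightarrow> 'a::{finite, discrete_topology}) measure) = sets borel"
proof
  let ?M = "seq_algebra :: ('i \<Rightarrow> 'a) measure"
  have coord: "{x. x i = a} \<in> sets ?M" for i :: 'i and a :: 'a
  proof -
    have "(\<lambda>x. x i) -` {a} \<inter> space ?M \<in> sets ?M"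
      unfolding seq_algebra_def by (rule measurable_sets[OF measurable_component_singleton]) auto
    then show ?thesis
      by (simp add: seq_algebra_def space_PiM vimage_def)
  qed
  define cyl where
    "cyl = (\<lambda>ps :: ('i \<times> 'a) list. {x :: 'i \<Rightarrow> 'a. \<forall>p \<in> set ps. x (fst p) = snd p})"
  have cyl: "cyl ps \<in> sets ?M" for ps
  proof (induction ps)
    case Nil
    have "space ?M \<in> sets ?M" by (rule sets.top)
    then show ?case by (simp add: cyl_def seq_algebra_def space_PiM)
  next
    case (Cons p ps)
    have "cyl (p # ps) = {x. x (fst p) = snd p} \<inter> cyl ps"
      by (auto simp: cyl_def)
    then show ?case using Cons coord by auto
  qed
  have op: "S \<in> sets ?M" if S: "open S" for S :: "('i \<Rightarrow> 'a) set"
  proof -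
    have "\<exists>ps. x \<in> cyl ps \<and> cyl ps \<subseteq> S" if x: "x \<in> S" for x
    proof -
      obtain X where X: "x \<in> (\<Pi>\<^sub>E i\<in>UNIV. X i)" "finite {i. X i \<noteq> UNIV}" "(\<Pi>\<^sub>E i\<in>UNIV. X i) \<subseteq> S"
        using product_topology_open_contains_basis[of "\<lambda>_. euclidean" UNIV S x] S x
        by (auto simp: open_fun_def)
      obtain js where js: "set js = {i. X i \<noteq> UNIV}" using finite_list[OF X(2)] by blast
      have "y \<in> S" if y: "y \<in> cyl (map (\<lambda>i. (i, x i)) js)" for y
      proof -
        have "y i \<in> X i" for i
          using y js X(1) by (cases "X i = UNIV") (auto simp: cyl_def PiE_iff)
        then show ?thesis using X(3) by auto
      qed
      then show ?thesis
        by (intro exI[of _ "map (\<lambda>i. (i, x i)) js"]) (auto simp: cyl_def)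
    qed
    then have "S = (\<Union>ps \<in> {ps. cyl ps \<subseteq> S}. cyl ps)" by blast
    also have "\<dots> \<in> sets ?M" using cyl by (intro sets.countable_UN') auto
    finally show ?thesis .
  qed
  show "sets (borel :: ('i \<Rightarrow> 'a) measure) \<subseteq> sets ?M"
  proof -
    have "space ?M = UNIV" by (simp add: seq_algebra_def space_PiM)
    then show ?thesis
      using op sets.sigma_sets_subset[of "{S. open S}" ?M] by (auto simp: borel_def)
  qed
  have "{x \<in> space borel. (x :: 'i \<Rightarrow> 'a) i = a} \<in> sets borel" for i a
  proof -
    have "open {f :: 'i \<Rightarrow> 'a. \<forall>j\<in>{i}. f j \<in> {a}}"
      by (rule product_topology_basis') (auto intro: discrete_topology_class.open_discrete)
    then show ?thesis by simp
  qed
  then have "(\<lambda>x. x) \<in> borel \<rightarrow>\<^sub>M ?M"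
    unfolding seq_algebra_def
    by (intro measurable_PiM_single') (auto simp: measurable_count_space_eq2_countable vimage_def)
  then show "sets ?M \<subseteq> sets borel"
    by (auto dest!: measurable_sets simp: seq_algebra_def space_PiM)
qed

end

theory Submission
  imports Defs
begin

text \<open>
  The averages \<open>(1 / k) * (\<Sum>i<k. \<mu>\<^bsup>x,-i\<^esup>)\<close> are almost invariant under the shift, with an
  error of order \<open>1 / k\<close>, so their weak limits are invariant; testing against functions of finitely
  many coordinates, which are continuous over a discrete finite alphabet, is enough because they
  determine a measure.

  For compatibility, note that each \<open>\<mu>\<^bsup>x,-i\<^esup>\<close> already satisfies the compatibility relation
  at the origin: for every bounded measurable \<open>p\<close> of the past, the integral of \<open>p\<close> over the event
  that the symbol at \<open>0\<close> is \<open>a\<close> equals the integral of \<open>p\<close> times \<open>g(past, a)\<close>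
  (\<open>integral_one_step\<close>). The relation is linear in the measure, so it passes to the averages. It has
  to survive the weak limit, and the difficulty is that \<open>g\<close> need not be continuous. Take for \<open>p\<close> the
  indicator of an event about finitely many coordinates and squeeze \<open>g\<close> between its lower and upper
  envelopes, the infimum and the supremum of \<open>g\<close> over all pasts that share the last \<open>n\<close> symbols. The
  envelopes depend on finitely many coordinates, so the two inequalities pass to the limit measure
  for each fixed \<open>n\<close>. As \<open>n\<close> grows, both envelopes converge to \<open>g\<close> exactly at the pasts where \<open>g\<close>
  is continuous, hence almost everywhere, and dominated convergence closes the gap
  (\<open>compatible_on_window_box\<close>). Events about finitely many past coordinates form a generator closed
  under intersection, which gives the conditional expectation.

  Two supporting facts are needed. The measure \<open>\<mu>\<^bsup>x\<^esup>\<close> is specified by a definite description, so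
  its existence and uniqueness are proved (\<open>ex_starts_from\<close>, \<open>starts_from_unique\<close>). The set of
  discontinuities is measurable (\<open>past_discontinuities_in_seq_algebra\<close>), since the hypothesis
  that it has measure zero yields an almost-everywhere statement only for a measurable set.
\<close>

section \<open>Functions of finitely many coordinates\<close>

lemma space_seq_algebra [simp]: "space (seq_algebra :: ('i \<Rightarrow> 'a) measure) = UNIV"
  by (simp add: seq_algebra_def space_PiM)

lemma measurable_coordinate [measurable]:
  "(\<lambda>y. y i) \<in> (seq_algebra :: ('i \<Rightarrow> 'a) measure) \<rightarrow>\<^sub>M count_space UNIV"
  unfolding seq_algebra_def by simp

lemma measurable_into_seq_algebra:
  assumes "\<And>i. (\<lambda>y. f y i) \<in> M \<rightarrow>\<^sub>M count_space UNIV"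
  shows "f \<in> M \<rightarrow>\<^sub>M seq_algebra"
  unfolding seq_algebra_def using assms by (intro measurable_PiM_single') auto

lemma open_agreement_set:
  fixes w :: "'i \<Rightarrow> 'a::discrete_topology"
  assumes "finite J"
  shows "open {y. \<forall>i\<in>J. y i = w i}"
proof -
  have "open {y. \<forall>i\<in>J. y i \<in> {w i}}"
    using assms by (intro product_topology_basis'[where x = id, simplified]) (auto intro: discrete_topology_class.open_discrete)
  then show ?thesis by simp
qed

lemma agreement_set_inside_open:
  fixes w :: "'i \<Rightarrow> 'a::topological_space"
  assumes "open S" "w \<in> S"
  obtains J where "finite J" "{y. \<forall>i\<in>J. y i = w i} \<subseteq> S"
proof -
  obtain X where X: "w \<in> (\<Pi>\<^sub>E i\<in>UNIV. X i)" "finite {i. X i \<noteq> UNIV}" "(\<Pi>\<^sub>E i\<in>UNIV. X i) \<subseteq> S"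
    using product_topology_open_contains_basis[of "\<lambda>_. euclidean" UNIV S w] assms
    by (auto simp: open_fun_def)
  have "y \<in> S" if "\<forall>i\<in>{i. X i \<noteq> UNIV}. y i = w i" for y
  proof -
    have "y i \<in> X i" for i
      using that X(1) by (cases "X i = UNIV") (auto simp: PiE_iff)
    then show ?thesis using X(3) by auto
  qed
  then show thesis using X(2) by (intro that[of "{i. X i \<noteq> UNIV}"]) auto
qed

text \<open>These are the test functions of the whole proof: over a finite discrete alphabet each of them is
  continuous, bounded and measurable, so weak convergence applies to it without further ado.\<close>

definition window_function :: "nat \<Rightarrow> ((int \<Rightarrow> 'a) \<Rightarrow> 'b) \<Rightarrow> bool" where
  "window_function n f \<longleftrightarrow> (\<forall>y z. (\<forall>i. \<bar>i\<bar> \<le> int n \<longrightarrow> y i = z i) \<longrightarrow> f y = f z)"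

lemma window_functionI:
  assumes "\<And>y z. (\<And>i. \<bar>i\<bar> \<le> int n \<Longrightarrow> y i = z i) \<Longrightarrow> f y = f z"
  shows "window_function n f"
  using assms unfolding window_function_def by blast

text \<open>A configuration can be replaced by its restriction to the window, and there are only finitely many
  of those.\<close>

lemma finite_range_window_function:
  fixes f :: "(int \<Rightarrow> 'a::finite) \<Rightarrow> 'b"
  assumes "window_function n f"
  shows "finite (range f)"
proof -
  let ?K = "PiE {-int n..int n} (\<lambda>_. UNIV :: 'a set)"
  have "f y \<in> f ` ?K" for y
  proof (rule image_eqI)
    show "f y = f (restrict y {-int n..int n})"
      using assms unfolding window_function_def by (auto simp: abs_le_iff)
  qed auto
  moreover have "finite (f ` ?K)" by (intro finite_imageI finite_PiE) auto
  ultimately show ?thesis by (meson finite_subset image_subsetI)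
qed

lemma continuous_window_function:
  fixes f :: "(int \<Rightarrow> 'a::discrete_topology) \<Rightarrow> 'b::topological_space"
  assumes "window_function n f"
  shows "continuous_on UNIV f"
proof -
  have "open (f -` S)" for S
  proof -
    have "f -` S = (\<Union>y \<in> f -` S. {z. \<forall>i\<in>{-int n..int n}. z i = y i})"
    proof (intro subset_antisym subsetI)
      fix z assume "z \<in> (\<Union>y \<in> f -` S. {z. \<forall>i\<in>{-int n..int n}. z i = y i})"
      then obtain y where "f y \<in> S" "\<forall>i\<in>{-int n..int n}. z i = y i" by auto
      then have "f z = f y" using assms unfolding window_function_def by (auto simp: abs_le_iff)
      then show "z \<in> f -` S" using \<open>f y \<in> S\<close> by simp
    qed auto
    moreover have "open (\<Union>y \<in> f -` S. {z. \<forall>i\<in>{-int n..int n}. z i = y i})"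
      by (intro open_UN ballI open_agreement_set) auto
    ultimately show ?thesis by simp
  qed
  then show ?thesis by (simp add: continuous_on_open_vimage)
qed

lemma measurable_window_function:
  fixes f :: "(int \<Rightarrow> 'a::{finite, discrete_topology}) \<Rightarrow> real"
  assumes "window_function n f"
  shows "f \<in> borel_measurable seq_algebra"
  using borel_measurable_continuous_onI[OF continuous_window_function[OF assms]]
    measurable_cong_sets[OF sets_seq_algebra_eq_borel refl] by blast

lemma bounded_window_function:
  fixes f :: "(int \<Rightarrow> 'a::finite) \<Rightarrow> real"
  assumes "window_function n f"
  shows "bounded (range f)"
  using finite_range_window_function[OF assms] by (rule finite_imp_bounded)

lemma weak_limit_window_function:
  fixes f :: "(int \<Rightarrow> 'a::{finite, discrete_topology}) \<Rightarrow> real"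
  assumes "weakly_converges N M" "window_function n f"
  shows "(\<lambda>j. \<integral>y. f y \<partial>N j) \<longlonglongrightarrow> (\<integral>y. f y \<partial>M)"
  using assms continuous_window_function bounded_window_function unfolding weakly_converges_def by blast

section \<open>Measures are determined by finite windows\<close>

text \<open>The window is intersected with an index set \<open>I\<close> so that the same family generates the full
  \<open>\<sigma>\<close>-algebra (\<open>I = UNIV\<close>) and the past \<open>\<sigma>\<close>-algebra (\<open>I = {..-1}\<close>).\<close>

definition window_box :: "int set \<Rightarrow> nat \<Rightarrow> (int \<Rightarrow> 'a) \<Rightarrow> (int \<Rightarrow> 'a) set" where
  "window_box I n y = {z. \<forall>i\<in>I. \<bar>i\<bar> \<le> int n \<longrightarrow> z i = y i}"

lemma window_function_window_box: "window_function n (\<lambda>z. F (z \<in> window_box I n y))"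
proof (rule window_functionI)
  fix u v :: "int \<Rightarrow> 'a" assume "\<And>i. \<bar>i\<bar> \<le> int n \<Longrightarrow> u i = v i"
  then have "u \<in> window_box I n y \<longleftrightarrow> v \<in> window_box I n y" by (auto simp: window_box_def)
  then show "F (u \<in> window_box I n y) = F (v \<in> window_box I n y)" by simp
qed

lemma finite_range_window_box:
  "finite (range (window_box I n :: (int \<Rightarrow> 'a::finite) \<Rightarrow> _))"
  by (rule finite_range_window_function[of n], rule window_functionI) (auto simp: window_box_def)

definition coordinate_events :: "int set \<Rightarrow> (int \<Rightarrow> 'a) set set" where
  "coordinate_events I = {{y. y i = a} | i a. i \<in> I}"

lemma sigma_sets_window_boxes:
  "sigma_sets UNIV (coordinate_events I) =
     sigma_sets UNIV (insert {} {window_box I n y | n y. True} :: (int \<Rightarrow> 'a::finite) set set)"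
    (is "?S = sigma_sets UNIV ?B")
proof (rule sigma_sets_eqI)
  interpret S: sigma_algebra UNIV ?S by (rule sigma_algebra_sigma_sets) simp
  interpret B: sigma_algebra UNIV "sigma_sets UNIV ?B" by (rule sigma_algebra_sigma_sets) simp
  fix A assume "A \<in> (coordinate_events I :: (int \<Rightarrow> 'a) set set)"
  then obtain i a where i: "i \<in> I" and A: "A = {y. y i = a}" by (auto simp: coordinate_events_def)
  let ?n = "nat \<bar>i\<bar>"
  have "A = \<Union> (window_box I ?n ` A)"
    using i by (auto simp: A window_box_def)
  moreover have "finite (window_box I ?n ` A)"
    by (rule finite_subset[OF _ finite_range_window_box]) auto
  then have "\<Union> (window_box I ?n ` A) \<in> sigma_sets UNIV ?B"
    by (intro B.finite_Union) (auto intro!: sigma_sets.Basic)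
  ultimately show "A \<in> sigma_sets UNIV ?B" by simp
next
  interpret S: sigma_algebra UNIV ?S by (rule sigma_algebra_sigma_sets) simp
  fix A assume "A \<in> ?B"
  then consider "A = {}" | n y where "A = window_box I n y" by blast
  then show "A \<in> ?S"
  proof cases
    case 2
    have "{z \<in> UNIV. \<forall>i \<in> I \<inter> {-int n..int n}. z i = y i} \<in> ?S"
      by (intro S.sets_Collect_finite_All) (auto intro!: sigma_sets.Basic simp: coordinate_events_def)
    also have "{z \<in> UNIV. \<forall>i \<in> I \<inter> {-int n..int n}. z i = y i} = A"
      by (auto simp: 2 window_box_def abs_le_iff)
    finally show ?thesis .
  qed auto
qed

text \<open>Windows are nested, so of two boxes over the same \<open>I\<close> the one with the larger window is either
  contained in the other or disjoint from it.\<close>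

lemma Int_stable_window_boxes: "Int_stable (insert {} {window_box I n y | n y. True})"
proof -
  have *: "window_box I m u \<inter> window_box I n v = {} \<or> window_box I m u \<inter> window_box I n v = window_box I n v" if "m \<le> n" for m n u v
    using that by (fastforce simp: window_box_def)
  have "window_box I m u \<inter> window_box I n v \<in> insert {} {window_box I n y | n y. True}" for m n u v
    using *[of m n u v] *[of n m v u] by (cases "m \<le> n") (auto simp: Int_commute)
  then show ?thesis
    unfolding Int_stable_def by (intro ballI, elim insertE CollectE exE conjE, simp_all)
qed

lemma measure_eqI_window_boxes:
  fixes M N :: "(int \<Rightarrow> 'a::finite) measure"
  assumes "sets M = sigma_sets UNIV (coordinate_events I)" "sets N = sigma_sets UNIV (coordinate_events I)"
    and "finite_measure M"
    and eq: "\<And>n y. emeasure M (window_box I n y) = emeasure N (window_box I n y)"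
  shows "M = N"
proof (rule measure_eqI_generator_eq_countable)
  interpret finite_measure M by fact
  let ?B = "insert {} {window_box I n y | n y. True} :: (int \<Rightarrow> 'a) set set"
  show "Int_stable ?B" by (rule Int_stable_window_boxes)
  show "sets M = sigma_sets UNIV ?B" "sets N = sigma_sets UNIV ?B"
    using assms(1,2) by (simp_all add: sigma_sets_window_boxes)
  show "emeasure M X = emeasure N X" if "X \<in> ?B" for X using that eq by auto
  show "countable (range (window_box I 0 :: (int \<Rightarrow> 'a) \<Rightarrow> _))"
    using finite_range_window_box by (rule countable_finite)
  show "\<Union> (range (window_box I 0 :: (int \<Rightarrow> 'a) \<Rightarrow> _)) = UNIV" by (auto simp: window_box_def)
  show "emeasure M X \<noteq> \<infinity>" for X by simp
qed auto

lemma sets_past_algebra: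
  "sets (past_algebra :: (int \<Rightarrow> 'a) measure) = sigma_sets UNIV (coordinate_events {..-1})"
proof -
  have "coordinate_events {..-1} = {{x :: int \<Rightarrow> 'a. x i = a} | i a. i \<le> - 1}"
    unfolding coordinate_events_def by simp
  then show ?thesis unfolding past_algebra_def by (simp only: sets_measure_of Pow_UNIV subset_UNIV)
qed

lemma space_past_algebra [simp]: "space past_algebra = UNIV"
  by (simp add: past_algebra_def)

lemma sets_seq_algebra:
  "sets seq_algebra = sigma_sets UNIV (coordinate_events UNIV :: (int \<Rightarrow> 'a::finite) set set)"
proof
  have "{y. y i = a} \<in> sets seq_algebra" for i :: int and a :: 'a
  proof -
    have "{y \<in> space seq_algebra. y i = a} \<in> sets seq_algebra" by measurable
    then show ?thesis by simp
  qed
  then show "sigma_sets UNIV (coordinate_events UNIV) \<subseteq> sets (seq_algebra :: (int \<Rightarrow> 'a) measure)"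
    using sets.sigma_sets_subset[of "coordinate_events UNIV" "seq_algebra :: (int \<Rightarrow> 'a) measure"]
    by (auto simp: coordinate_events_def)
  let ?N = "sigma UNIV (coordinate_events UNIV) :: (int \<Rightarrow> 'a) measure"
  have "(\<lambda>y. y i) \<in> ?N \<rightarrow>\<^sub>M count_space UNIV" for i
    by (auto simp: measurable_count_space_eq2_countable vimage_def coordinate_events_def)
  then have "(\<lambda>y. y) \<in> ?N \<rightarrow>\<^sub>M seq_algebra" by (rule measurable_into_seq_algebra)
  then show "sets seq_algebra \<subseteq> sigma_sets UNIV (coordinate_events UNIV :: (int \<Rightarrow> 'a) set set)"
    by (auto dest!: measurable_sets)
qed

lemma subalgebra_past_algebra:
  fixes M :: "(int \<Rightarrow> 'a::finite) measure"
  assumes "sets M = sets seq_algebra"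
  shows "subalgebra M past_algebra"
  unfolding subalgebra_def assms sets_past_algebra sets_seq_algebra
  using sets_eq_imp_space_eq[OF assms]
  by (intro conjI sigma_sets_mono') (auto simp: coordinate_events_def)

lemma window_box_in_seq_algebra: "window_box I n y \<in> sets (seq_algebra :: (int \<Rightarrow> 'a::finite) measure)"
proof -
  have "{z \<in> space seq_algebra. \<forall>i\<in>I. \<bar>i\<bar> \<le> int n \<longrightarrow> z i = y i} \<in> sets (seq_algebra :: (int \<Rightarrow> 'a) measure)"
    by measurable
  then show ?thesis by (simp add: window_box_def)
qed

lemma past_eq_iff: "past y = past z \<longleftrightarrow> (\<forall>i\<le>-1. y i = z i)"
proof
  assume *: "past y = past z"
  have "y i = z i" if "i \<le> -1" for i
    using fun_cong[OF *, of "nat (-1 - i)"] that by (simp add: past_def)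
  then show "\<forall>i\<le>-1. y i = z i" by blast
qed (auto simp: past_def)

lemma cylinder_in_seq_algebra: "cylinder m as \<in> sets (seq_algebra :: (int \<Rightarrow> 'a::finite) measure)"
proof -
  have "{z \<in> space seq_algebra. \<forall>i<length as. z (m + int i) = as ! i} \<in> sets (seq_algebra :: (int \<Rightarrow> 'a) measure)"
    by measurable
  then show ?thesis by (simp add: cylinder_def)
qed

lemma window_box_in_past_algebra:
  "window_box {..-1} n y \<in> sets (past_algebra :: (int \<Rightarrow> 'a::finite) measure)"
  unfolding sets_past_algebra sigma_sets_window_boxes by (intro sigma_sets.Basic) blast

text \<open>This makes the clause on past events in the specification of \<open>past_measure\<close> meaningful: the indicator of
  \<open>C\<close> takes the same value at every extension of a past.\<close>

lemma past_algebra_respects_past: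
  assumes "C \<in> sets past_algebra" "past y = past z"
  shows "y \<in> C \<longleftrightarrow> z \<in> C"
  using assms(1) unfolding sets_past_algebra
proof induction
  case (Basic A)
  then show ?case using assms(2) by (auto simp: coordinate_events_def past_eq_iff)
qed auto

lemma window_box_past_iff:
  "z \<in> window_box {..-1} n y \<longleftrightarrow> past z \<in> {w. \<forall>k<n. w k = past y k}"
proof
  assume *: "past z \<in> {w. \<forall>k<n. w k = past y k}"
  have "z i = y i" if "i \<le> -1" "\<bar>i\<bar> \<le> int n" for i
  proof -
    have "nat (-1 - i) < n" using that by auto
    then have "past z (nat (-1 - i)) = past y (nat (-1 - i))" using * by blast
    then show ?thesis using that by (simp add: past_def)
  qed
  then show "z \<in> window_box {..-1} n y" by (auto simp: window_box_def)
qed (auto simp: window_box_def past_def)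

lemma measurable_past: "past \<in> past_algebra \<rightarrow>\<^sub>M (seq_algebra :: (nat \<Rightarrow> 'a::finite) measure)"
proof (rule measurable_into_seq_algebra)
  fix k
  show "(\<lambda>y. past y k :: 'a) \<in> past_algebra \<rightarrow>\<^sub>M count_space UNIV"
    unfolding measurable_count_space_eq2_countable past_def
    by (auto simp: sets_past_algebra vimage_def coordinate_events_def intro!: sigma_sets.Basic)
qed

lemma measurable_past_seq_algebra [measurable]:
  "past \<in> seq_algebra \<rightarrow>\<^sub>M (seq_algebra :: (nat \<Rightarrow> 'a::finite) measure)"
  using measurable_from_subalg[OF subalgebra_past_algebra[OF refl] measurable_past] .

lemma measurable_snoc: "(\<lambda>w. snoc w a) \<in> seq_algebra \<rightarrow>\<^sub>M seq_algebra"
  by (rule measurable_into_seq_algebra) (auto simp: snoc_def split: nat.split)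

lemma measurable_shift: "shift \<in> seq_algebra \<rightarrow>\<^sub>M (seq_algebra :: (int \<Rightarrow> 'a) measure)"
  unfolding shift_def by (rule measurable_into_seq_algebra) simp

lemma shift_funpow: "(shift ^^ i) y = (\<lambda>n. y (n + int i))"
  by (induction i) (auto simp: shift_def algebra_simps)

lemma measurable_shift_funpow [measurable]:
  "shift ^^ i \<in> seq_algebra \<rightarrow>\<^sub>M (seq_algebra :: (int \<Rightarrow> 'a) measure)"
  by (rule measurable_into_seq_algebra) (simp add: shift_funpow)

section \<open>Existence and uniqueness of the measure started from a past\<close>

lemma conc_Nil [simp]: "conc w [] = w"
  by (simp add: conc_def)

lemma conc_append_single [simp]: "conc w (as @ [b]) = snoc (conc w as) b"
  by (simp add: conc_def)

lemma g_string_eq_prod: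
  "g_string g w as = (\<Prod>i<length as. g (snoc (conc w (take i as)) (as ! i)))"
proof -
  have "g (conc w (take (Suc i) as)) = g (snoc (conc w (take i as)) (as ! i))" if "i < length as" for i
    using that by (simp add: take_Suc_conv_app_nth)
  then show ?thesis
    by (simp add: g_string_def prod.atLeast1_atMost_eq)
qed

lemma g_string_snoc:
  "g_string g w (as @ [b]) = g_string g w as * g (snoc (conc w as) b)"
  by (simp add: g_string_eq_prod nth_append)

locale g_kernel =
  fixes g :: "'a::{finite, discrete_topology} left_seq \<Rightarrow> real"
  assumes g_function: "g_function g"
begin

lemma g_nonneg: "0 \<le> g w" and g_le_1: "g w \<le> 1" and sum_g: "(\<Sum>a\<in>UNIV. g (snoc w a)) = 1"
  and measurable_g [measurable]: "g \<in> borel_measurable seq_algebra"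
  using g_function by (auto simp: g_function_def)

definition next_symbol :: "'a left_seq \<Rightarrow> 'a pmf" where
  "next_symbol w = embed_pmf (\<lambda>a. g (snoc w a))"

lemma pmf_next_symbol: "pmf (next_symbol w) a = g (snoc w a)"
  unfolding next_symbol_def
  by (rule pmf_embed_pmf)
     (auto simp: g_nonneg nn_integral_count_space_finite sum_ennreal sum_g)

end

text \<open>The process started from \<open>w\<close> is built from independent variables indexed by strings: \<open>\<xi> as\<close> is
  the symbol that would be emitted after the history \<open>as\<close>, with law \<open>next_symbol (conc w as)\<close>. The
  trajectory reads off at each time the variable attached to the history so far. Distinct histories
  use distinct variables, so the probability of a string is the product defining \<open>g_string\<close>, and
  an infinite product measure over the countable set of strings suffices.\<close>

primrec trajectory :: "('a list \<Rightarrow> 'a) \<Rightarrow> nat \<Rightarrow> 'a list" where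
  "trajectory \<xi> 0 = []"
| "trajectory \<xi> (Suc n) = trajectory \<xi> n @ [\<xi> (trajectory \<xi> n)]"

text \<open>The event of following a given string involves only the variables indexed by its proper prefixes;
  it is therefore a finite-dimensional event of the product measure.\<close>

lemma trajectory_eq_iff:
  "trajectory \<xi> (length as) = as \<longleftrightarrow> (\<forall>i<length as. \<xi> (take i as) = as ! i)"
proof (induction as rule: rev_induct)
  case (snoc a as)
  then show ?case by (auto simp: nth_append less_Suc_eq)
qed simp

lemma trajectory_eq_iff_fed_back:
  "trajectory \<xi> (length as) = as \<longleftrightarrow> (\<forall>i<length as. \<xi> (trajectory \<xi> i) = as ! i)"
proof (induction as rule: rev_induct)
  case (snoc a as)
  then show ?case by (auto simp: nth_append less_Suc_eq)
qed simp

definition join_past :: "'a left_seq \<Rightarrow> (nat \<Rightarrow> 'a) \<Rightarrow> (int \<Rightarrow> 'a)" where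
  "join_past w \<eta> = (\<lambda>i. if i < 0 then w (nat (- 1 - i)) else \<eta> (nat i))"

lemma past_join_past [simp]: "past (join_past w \<eta>) = w"
  by (simp add: past_def join_past_def)

text \<open>The index of the variable that is read is itself random, but it ranges over a countable set.\<close>

lemma measurable_trajectory:
  fixes M :: "'a::finite list \<Rightarrow> 'a measure"
  assumes "\<And>s. sets (M s) = UNIV"
  shows "(\<lambda>\<xi>. trajectory \<xi> n) \<in> PiM UNIV M \<rightarrow>\<^sub>M count_space UNIV"
    and "(\<lambda>\<xi>. \<xi> (trajectory \<xi> n)) \<in> PiM UNIV M \<rightarrow>\<^sub>M count_space UNIV"
proof -
  have M: "sets (M s) = sets (count_space UNIV)" for s using assms by simp
  have coord: "(\<lambda>\<xi>. \<xi> s) \<in> PiM UNIV M \<rightarrow>\<^sub>M count_space UNIV" for s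
    using measurable_cong_sets[OF refl M] measurable_component_singleton[of s UNIV M] by blast
  show traj: "(\<lambda>\<xi>. trajectory \<xi> n) \<in> PiM UNIV M \<rightarrow>\<^sub>M count_space UNIV" for n
  proof (induction n)
    case (Suc n)
    have "(\<lambda>\<xi>. s @ [\<xi> s]) \<in> PiM UNIV M \<rightarrow>\<^sub>M count_space UNIV" for s
      by (rule measurable_compose[OF coord]) simp
    from measurable_compose_countable[OF this Suc] show ?case by simp
  qed simp
  show "(\<lambda>\<xi>. \<xi> (trajectory \<xi> n)) \<in> PiM UNIV M \<rightarrow>\<^sub>M count_space UNIV"
    using measurable_compose_countable[OF coord traj] .
qed

text \<open>The predicate of which \<open>past_measure\<close> selects the unique solution.\<close>

definition starts_from ::
  "('a left_seq \<Rightarrow> real) \<Rightarrow> 'a left_seq \<Rightarrow> (int \<Rightarrow> 'a) measure \<Rightarrow> bool" where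
  "starts_from g w M \<longleftrightarrow> prob_space M \<and> sets M = sets seq_algebra \<and>
     (\<forall>C \<in> sets past_algebra. \<forall>y. past y = w \<longrightarrow> measure M C = indicator C y) \<and>
     (\<forall>as. as \<noteq> [] \<longrightarrow> measure M (cylinder 0 as) = g_string g w as)"

context g_kernel
begin

lemma ex_starts_from: "\<exists>M. starts_from g w M"
proof -
  define K where "K = (\<lambda>as. measure_pmf (next_symbol (conc w as)))"
  have "prob_space (K s)" for s by (simp add: K_def measure_pmf.prob_space_axioms)
  then interpret product_prob_space K UNIV by (rule product_prob_spaceI)
  define Y where "Y = (\<lambda>\<xi>. join_past w (\<lambda>n. \<xi> (trajectory \<xi> n)))"
  have K: "sets (K s) = UNIV" for s by (simp add: K_def)
  have [measurable]: "Y \<in> PiM UNIV K \<rightarrow>\<^sub>M seq_algebra"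
  proof (rule measurable_into_seq_algebra)
    show "(\<lambda>\<xi>. Y \<xi> i) \<in> PiM UNIV K \<rightarrow>\<^sub>M count_space UNIV" for i
      using measurable_trajectory(2)[of K "nat i", OF K] by (cases "i < 0") (auto simp: Y_def join_past_def)
  qed
  have sp: "space (PiM UNIV K) = UNIV" by (simp add: space_PiM K_def)
  define M where "M = distr (PiM UNIV K) seq_algebra Y"
  have meas: "measure M C = measure (PiM UNIV K) (Y -` C)" if "C \<in> sets seq_algebra" for C
    using that by (simp add: M_def measure_distr sp)
  have "prob_space M" unfolding M_def by (rule P.prob_space_distr) measurable
  moreover have "measure M C = indicator C y" if C: "C \<in> sets past_algebra" and y: "past y = w" for C y
  proof -
    have "C \<in> sets seq_algebra" using subalgebra_past_algebra[OF refl] C by (auto simp: subalgebra_def)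
    moreover have "Y \<xi> \<in> C \<longleftrightarrow> y \<in> C" for \<xi>
      using y by (intro past_algebra_respects_past[OF C]) (simp add: Y_def)
    then have "Y -` C = (if y \<in> C then space (PiM UNIV K) else {})"
      by (auto simp: sp)
    ultimately show ?thesis by (auto simp: meas P.prob_space simp del: sp)
  qed
  moreover have "measure M (cylinder 0 as) = g_string g w as" for as
  proof -
    let ?n = "length as"
    define J where "J = (\<lambda>i. take i as) ` {..<?n}"
    have inj: "inj_on (\<lambda>i. take i as) {..<?n}"
    proof (rule inj_onI)
      fix i j assume ij: "i \<in> {..<?n}" "j \<in> {..<?n}" and "take i as = take j as"
      then have "length (take i as) = length (take j as)" by simp
      then show "i = j" using ij by simp
    qed
    have "{z \<in> space seq_algebra. \<forall>i<?n. z (int i) = as ! i} \<in> sets seq_algebra" by measurable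
    then have "cylinder 0 as \<in> sets seq_algebra" by (simp add: cylinder_def)
    moreover have "Y -` cylinder 0 as = {\<xi>. trajectory \<xi> ?n = as}"
      unfolding trajectory_eq_iff_fed_back by (auto simp: Y_def cylinder_def join_past_def)
    \<comment> \<open>A prefix determines, by its length, the symbol that its variable has to emit.\<close>
    moreover have "\<dots> = prod_emb UNIV K J (PiE J (\<lambda>s. {as ! length s}))"
      unfolding trajectory_eq_iff by (auto simp: prod_emb_def J_def K_def PiE_iff)
    ultimately have "measure M (cylinder 0 as) = (\<Prod>s\<in>J. measure (K s) {as ! length s})"
      using measure_PiM_emb[of J "\<lambda>s. {as ! length s}"] by (simp add: meas J_def K)
    also have "\<dots> = (\<Prod>i<?n. measure (K (take i as)) {as ! i})"
      unfolding J_def by (subst prod.reindex[OF inj]) simp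
    also have "\<dots> = g_string g w as"
      by (simp add: g_string_eq_prod K_def measure_pmf_single pmf_next_symbol)
    finally show ?thesis .
  qed
  ultimately have "starts_from g w M" by (auto simp: starts_from_def M_def)
  then show ?thesis ..
qed

text \<open>The negative coordinates are deterministic, so the past part of the box has probability \<open>0\<close> or
  \<open>1\<close> and is independent of the cylinder on the nonnegative coordinates. The value \<open>undefined\<close> fills
  nonnegative coordinates that the past part of the box ignores.\<close>

lemma starts_from_window_box:
  assumes "starts_from g w M"
  shows "measure M (window_box UNIV n y) =
    indicator (window_box {..-1} n y) (join_past w undefined) * g_string g w (map (\<lambda>k. y (int k)) [0..<Suc n])"
proof -
  interpret prob_space M using assms by (simp add: starts_from_def)
  let ?P = "window_box {..-1} n y" and ?as = "map (\<lambda>k. y (int k)) [0..<Suc n]"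
  have sets: "sets M = sets seq_algebra" using assms by (simp add: starts_from_def)
  have Q: "cylinder 0 ?as \<in> sets M" "prob (cylinder 0 ?as) = g_string g w ?as"
    using assms by (simp_all add: starts_from_def cylinder_in_seq_algebra)
  have P: "?P \<in> sets M" by (simp add: sets window_box_in_seq_algebra)
  have "?P \<in> sets past_algebra" by (rule window_box_in_past_algebra)
  then have mP: "prob ?P = indicator ?P (join_past w undefined)"
    using assms by (auto simp: starts_from_def)
  have "window_box UNIV n y = ?P \<inter> cylinder 0 ?as"
  proof (intro set_eqI iffI)
    fix z assume z: "z \<in> ?P \<inter> cylinder 0 ?as"
    have "z i = y i" if "\<bar>i\<bar> \<le> int n" for i
    proof (cases "i < 0")
      case True then show ?thesis using z that by (auto simp: window_box_def)
    next
      case False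
      then have "nat i < length ?as" using that by auto
      then have "z (0 + int (nat i)) = ?as ! nat i" using z unfolding cylinder_def by blast
      moreover have "?as ! nat i = y i" using False \<open>nat i < length ?as\<close> by (simp del: upt_Suc)
      ultimately show ?thesis using False by simp
    qed
    then show "z \<in> window_box UNIV n y" by (simp add: window_box_def)
  qed (auto simp: window_box_def cylinder_def simp del: upt_Suc)
  also have "prob (?P \<inter> cylinder 0 ?as) = prob ?P * prob (cylinder 0 ?as)"
  proof (cases "join_past w undefined \<in> ?P")
    case True
    then have "prob ?P = 1" using mP by simp
    then have "AE z in M. z \<in> ?P" by (simp add: prob_eq_1 P)
    then have "prob (?P \<inter> cylinder 0 ?as) = prob (cylinder 0 ?as)"
      using P Q by (intro finite_measure_eq_AE) auto
    then show ?thesis using \<open>prob ?P = 1\<close> by simp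
  next
    case False
    then have "prob ?P = 0" using mP by simp
    moreover have "prob (?P \<inter> cylinder 0 ?as) \<le> prob ?P"
      using P by (intro finite_measure_mono) auto
    ultimately show ?thesis by (simp add: measure_le_0_iff)
  qed
  finally show ?thesis using mP Q by simp
qed

lemma starts_from_unique:
  assumes M: "starts_from g w M" and N: "starts_from g w N"
  shows "M = N"
proof (rule measure_eqI_window_boxes)
  interpret M: prob_space M using M by (simp add: starts_from_def)
  interpret N: prob_space N using N by (simp add: starts_from_def)
  show "sets M = sigma_sets UNIV (coordinate_events UNIV)" "sets N = sigma_sets UNIV (coordinate_events UNIV)"
    using M N by (simp_all add: starts_from_def sets_seq_algebra)
  show "finite_measure M" by unfold_locales
  show "emeasure M (window_box UNIV n y) = emeasure N (window_box UNIV n y)" for n y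
    unfolding M.emeasure_eq_measure N.emeasure_eq_measure
    by (simp only: starts_from_window_box[OF M] starts_from_window_box[OF N])
qed

lemma starts_from_past_measure: "starts_from g w (past_measure g w)"
proof -
  have "past_measure g w = (THE M. starts_from g w M)"
    by (simp add: past_measure_def starts_from_def)
  moreover have "\<exists>!M. starts_from g w M" using ex_starts_from starts_from_unique by blast
  ultimately show ?thesis by (metis theI')
qed

end

section \<open>Shifts of the started measure satisfy the compatibility relation\<close>

lemma past_shift_Suc: "past ((shift ^^ Suc i) z) = snoc (past ((shift ^^ i) z)) (z (int i))"
  by (auto simp: past_def snoc_def shift_funpow shift_def fun_eq_iff algebra_simps split: nat.split)

lemma past_shift_eq_conc:
  "past ((shift ^^ i) z) = conc (past z) (map (\<lambda>j. z (int j)) [0..<i])"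
proof (induction i)
  case (Suc i)
  then show ?case unfolding past_shift_Suc by simp
qed simp

lemma sum_lists_Suc:
  fixes F :: "'a::finite list \<Rightarrow> 'b::comm_monoid_add"
  shows "(\<Sum>as | length as = Suc n. F as) = (\<Sum>as | length as = n. \<Sum>b\<in>UNIV. F (as @ [b]))"
proof -
  have "(\<Sum>as | length as = n. \<Sum>b\<in>UNIV. F (as @ [b])) = (\<Sum>(as, b) \<in> {as. length as = n} \<times> UNIV. F (as @ [b]))"
    by (rule sum.cartesian_product)
  also have "\<dots> = (\<Sum>as | length as = Suc n. F as)"
    by (rule sum.reindex_bij_witness[of _ "\<lambda>as. (butlast as, last as)" "\<lambda>(as, b). as @ [b]"])
       (auto simp: length_Suc_conv_rev)
  finally show ?thesis by simp
qed

text \<open>Strings of length \<open>n\<close> occupy the coordinates from \<open>0\<close> to \<open>n - 1\<close>, inside the window of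
  radius \<open>n\<close>.\<close>

lemma window_function_prefix: "window_function n (\<lambda>z. h (map (\<lambda>j. z (int j)) [0..<n]))"
proof (rule window_functionI)
  fix y z :: "int \<Rightarrow> 'a" assume "\<And>i. \<bar>i\<bar> \<le> int n \<Longrightarrow> y i = z i"
  then have "map (\<lambda>j. y (int j)) [0..<n] = map (\<lambda>j. z (int j)) [0..<n]" by auto
  then show "h (map (\<lambda>j. y (int j)) [0..<n]) = h (map (\<lambda>j. z (int j)) [0..<n])" by (simp only:)
qed

context g_kernel
begin

lemma AE_past_measure_past: "AE z in past_measure g w. past z = w"
proof -
  let ?M = "past_measure g w"
  interpret prob_space ?M using starts_from_past_measure[of w] by (simp add: starts_from_def)
  have sets: "sets ?M = sets seq_algebra" using starts_from_past_measure[of w] by (simp add: starts_from_def)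
  have "AE z in ?M. past z k = w k" for k
  proof -
    let ?C = "{z. z (- 1 - int k) = w k}"
    have C: "?C \<in> sets past_algebra"
      unfolding sets_past_algebra by (rule sigma_sets.Basic) (auto simp: coordinate_events_def)
    have "prob ?C = indicator ?C (join_past w undefined)"
      using starts_from_past_measure[of w] C past_join_past unfolding starts_from_def by blast
    then have "prob ?C = 1" by (simp add: join_past_def)
    moreover have "?C \<in> sets ?M"
      using C subalgebra_past_algebra[OF sets] by (auto simp: subalgebra_def)
    ultimately have "AE z in ?M. z \<in> ?C" by (simp add: prob_eq_1)
    then show ?thesis by (simp add: past_def)
  qed
  then have "AE z in ?M. \<forall>k. past z k = w k" by (simp add: AE_all_countable)
  then show ?thesis by (simp add: fun_eq_iff)
qed

lemma integral_past_measure_prefix: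
  fixes h :: "'a list \<Rightarrow> real"
  assumes "0 < n"
  shows "(\<integral>z. h (map (\<lambda>j. z (int j)) [0..<n]) \<partial>past_measure g w) =
    (\<Sum>as | length as = n. h as * g_string g w as)"
proof -
  let ?M = "past_measure g w" and ?A = "{as :: 'a list. length as = n}"
  interpret prob_space ?M using starts_from_past_measure[of w] by (simp add: starts_from_def)
  have sets: "sets ?M = sets seq_algebra" using starts_from_past_measure[of w] by (simp add: starts_from_def)
  have fin: "finite ?A" using finite_lists_length_eq[of "UNIV :: 'a set" n] by simp
  have prefix: "z \<in> cylinder 0 as \<longleftrightarrow> map (\<lambda>j. z (int j)) [0..<n] = as" if "as \<in> ?A" for z as
    using that by (auto simp: cylinder_def list_eq_iff_nth_eq)
  have "h (map (\<lambda>j. z (int j)) [0..<n]) = (\<Sum>as\<in>?A. h as * indicator (cylinder 0 as) z)" for z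
  proof -
    have "(\<Sum>as\<in>?A. h as * indicator (cylinder 0 as) z) =
        (\<Sum>as\<in>?A. if map (\<lambda>j. z (int j)) [0..<n] = as then h as else 0)"
      by (intro sum.cong) (auto simp: indicator_def prefix)
    also have "\<dots> = h (map (\<lambda>j. z (int j)) [0..<n])" by (simp add: fin)
    finally show ?thesis by simp
  qed
  then have "(\<integral>z. h (map (\<lambda>j. z (int j)) [0..<n]) \<partial>?M) = (\<integral>z. (\<Sum>as\<in>?A. h as * indicator (cylinder 0 as) z) \<partial>?M)"
    by simp
  also have "\<dots> = (\<Sum>as\<in>?A. h as * prob (cylinder 0 as))"
  proof -
    have "integrable ?M (\<lambda>z. h as * indicator (cylinder 0 as) z :: real)" for as
      by (intro integrable_mult_right integrable_real_indicator)
         (auto simp: sets cylinder_in_seq_algebra less_top[symmetric])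
    then show ?thesis by (simp add: sets_eq_imp_space_eq[OF sets])
  qed
  also have "\<dots> = (\<Sum>as\<in>?A. h as * g_string g w as)"
  proof (rule sum.cong)
    fix as assume "as \<in> ?A"
    then have "as \<noteq> []" using assms by auto
    then show "h as * prob (cylinder 0 as) = h as * g_string g w as"
      using starts_from_past_measure[of w] by (simp add: starts_from_def)
  qed simp
  finally show ?thesis .
qed

text \<open>After \<open>i\<close> shifts the past is almost surely \<open>w\<close> followed by a string of length \<open>i\<close>, and the symbol
  at \<open>0\<close> is the next one. Both integrals are then finite sums over strings: the left one picks the
  factor \<open>g(past, a)\<close> from the weight of the extended string, and in the right one the weights of
  all extensions sum to that of the string because \<open>g\<close> is normalised.\<close>

lemma integral_one_step:
  fixes p :: "'a left_seq \<Rightarrow> real"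
  assumes p [measurable]: "p \<in> borel_measurable seq_algebra"
  shows "(\<integral>z. p (past z) * indicator {z. z 0 = a} z \<partial>shifted_past_measure g w i) =
         (\<integral>z. p (past z) * g (snoc (past z) a) \<partial>shifted_past_measure g w i)"
proof -
  let ?M = "past_measure g w"
  note [measurable] = measurable_snoc
  have sets: "sets ?M = sets seq_algebra" using starts_from_past_measure[of w] by (simp add: starts_from_def)
  note [measurable_cong] = sets
  have eval: "(\<integral>z. F (past z) (z 0) \<partial>shifted_past_measure g w i) =
      (\<Sum>as | length as = i. \<Sum>b\<in>UNIV. F (conc w as) b * (g_string g w as * g (snoc (conc w as) b)))"
    if F [measurable]: "(\<lambda>z. F (past z) (z 0)) \<in> borel_measurable seq_algebra" for F
  proof -
    define h where "h = (\<lambda>as. F (conc w (take i as)) (as ! i))"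
    have "(\<integral>z. F (past z) (z 0) \<partial>shifted_past_measure g w i) =
        (\<integral>z. F (past ((shift ^^ i) z)) ((shift ^^ i) z 0) \<partial>?M)"
      unfolding shifted_past_measure_def by (rule integral_distr) measurable
    also have "\<dots> = (\<integral>z. h (map (\<lambda>j. z (int j)) [0..<Suc i]) \<partial>?M)"
    proof (rule integral_cong_AE)
      show "(\<lambda>z. F (past ((shift ^^ i) z)) ((shift ^^ i) z 0)) \<in> borel_measurable ?M"
        by (rule measurable_compose[OF _ F]) measurable
      show "(\<lambda>z. h (map (\<lambda>j. z (int j)) [0..<Suc i])) \<in> borel_measurable ?M"
        using measurable_window_function[OF window_function_prefix] measurable_cong_sets[OF sets refl] by blast
      have at_0: "(shift ^^ i) z 0 = z (int i)" for z :: "int \<Rightarrow> 'a" by (simp add: shift_funpow)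
      have "h (map (\<lambda>j. z (int j)) [0..<Suc i]) = F (conc w (map (\<lambda>j. z (int j)) [0..<i])) (z (int i))" for z
        by (simp add: h_def nth_append)
      then show "AE z in ?M. F (past ((shift ^^ i) z)) ((shift ^^ i) z 0) = h (map (\<lambda>j. z (int j)) [0..<Suc i])"
        using AE_past_measure_past[of w] by (auto simp: past_shift_eq_conc at_0 simp del: upt_Suc)
    qed
    also have "\<dots> = (\<Sum>as | length as = i. \<Sum>b\<in>UNIV. h (as @ [b]) * g_string g w (as @ [b]))"
      by (simp only: integral_past_measure_prefix zero_less_Suc sum_lists_Suc)
    finally show ?thesis by (simp add: h_def nth_append g_string_snoc)
  qed
  have "(\<integral>z. p (past z) * indicator {z. z 0 = a} z \<partial>shifted_past_measure g w i) =
      (\<integral>z. p (past z) * indicator {a} (z 0) \<partial>shifted_past_measure g w i)"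
    by (intro Bochner_Integration.integral_cong) (auto simp: indicator_def)
  also have "\<dots> = (\<Sum>as | length as = i. \<Sum>b\<in>UNIV. p (conc w as) * indicator {a} b * (g_string g w as * g (snoc (conc w as) b)))"
    by (rule eval[where F = "\<lambda>u b. p u * indicator {a} b"]) measurable
  also have "\<dots> = (\<Sum>as | length as = i. p (conc w as) * g_string g w as * g (snoc (conc w as) a))"
  proof (rule sum.cong[OF refl])
    fix as
    have "(\<Sum>b\<in>UNIV. p (conc w as) * indicator {a} b * (g_string g w as * g (snoc (conc w as) b))) =
      (\<Sum>b\<in>UNIV. if b = a then p (conc w as) * g_string g w as * g (snoc (conc w as) a) else 0)"
      by (intro sum.cong) (auto simp: indicator_def)
    then show "(\<Sum>b\<in>UNIV. p (conc w as) * indicator {a} b * (g_string g w as * g (snoc (conc w as) b))) =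
      p (conc w as) * g_string g w as * g (snoc (conc w as) a)" by simp
  qed
  also have "\<dots> = (\<Sum>as | length as = i. \<Sum>b\<in>UNIV. p (conc w as) * g (snoc (conc w as) a) * (g_string g w as * g (snoc (conc w as) b)))"
    by (simp add: sum_distrib_left[symmetric] sum_g, simp add: mult_ac)
  also have "\<dots> = (\<integral>z. p (past z) * g (snoc (past z) a) \<partial>shifted_past_measure g w i)"
    by (rule eval[where F = "\<lambda>u b. p u * g (snoc u a)", symmetric]) measurable
  finally show ?thesis .
qed

lemma prob_space_shifted_past_measure: "prob_space (shifted_past_measure g w i)"
  and sets_shifted_past_measure [measurable_cong]: "sets (shifted_past_measure g w i) = sets seq_algebra"
proof -
  interpret prob_space "past_measure g w" using starts_from_past_measure[of w] by (simp add: starts_from_def)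
  have sets: "sets (past_measure g w) = sets seq_algebra" using starts_from_past_measure[of w] by (simp add: starts_from_def)
  have "shift ^^ i \<in> past_measure g w \<rightarrow>\<^sub>M seq_algebra"
    using measurable_shift_funpow measurable_cong_sets[OF sets refl] by blast
  then show "prob_space (shifted_past_measure g w i)"
    unfolding shifted_past_measure_def by (rule prob_space_distr)
qed (simp add: shifted_past_measure_def)

text \<open>Drawing the number of shifts uniformly represents the average as a mixture, so that the laws for
  integrals against mixtures apply.\<close>

lemma averaged_past_measure_eq_bind:
  assumes "0 < k"
  shows "averaged_past_measure g w k = measure_pmf (pmf_of_set {..<k}) \<bind> shifted_past_measure g w"
    (is "_ = ?B")
proof -
  have M: "shifted_past_measure g w \<in> measure_pmf (pmf_of_set {..<k}) \<rightarrow>\<^sub>M subprob_algebra seq_algebra"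
    by (auto simp: space_subprob_algebra sets_shifted_past_measure
             intro: prob_space_imp_subprob_space prob_space_shifted_past_measure)
  have sets: "sets ?B = sets seq_algebra" by (rule sets_bind[OF _ _]) (auto simp: sets_shifted_past_measure)
  have "ennreal (1 / real k) * (\<Sum>i<k. emeasure (shifted_past_measure g w i) C) = emeasure ?B C"
    if "C \<in> sets seq_algebra" for C
  proof -
    have "emeasure ?B C = (\<integral>\<^sup>+i. emeasure (shifted_past_measure g w i) C \<partial>pmf_of_set {..<k})"
      by (rule emeasure_bind[OF _ M that]) simp
    also have "\<dots> = (\<Sum>i<k. emeasure (shifted_past_measure g w i) C) / k"
      using assms by (subst nn_integral_pmf_of_set) auto
    finally show ?thesis
      using assms by (simp add: divide_ennreal_def mult.commute inverse_eq_divide[symmetric] inverse_ennreal ennreal_of_nat_eq_real_of_nat)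
  qed
  then have "averaged_past_measure g w k = measure_of UNIV (sets seq_algebra) (emeasure ?B)"
    unfolding averaged_past_measure_def
    by (intro measure_of_eq) (simp_all add: sets.sigma_sets_eq[of seq_algebra, simplified])
  also have "\<dots> = ?B"
    using measure_of_of_measure[of ?B] by (simp add: sets sets_eq_imp_space_eq[OF sets])
  finally show ?thesis .
qed

lemma integral_averaged_past_measure:
  fixes f :: "(int \<Rightarrow> 'a) \<Rightarrow> real"
  assumes "0 < k" and [measurable]: "f \<in> borel_measurable seq_algebra" and "\<And>z. \<bar>f z\<bar> \<le> c"
  shows "(\<integral>z. f z \<partial>averaged_past_measure g w k) = (\<Sum>i<k. \<integral>z. f z \<partial>shifted_past_measure g w i) / real k"
proof -
  have M: "shifted_past_measure g w \<in> measure_pmf (pmf_of_set {..<k}) \<rightarrow>\<^sub>M subprob_algebra seq_algebra"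
    by (auto simp: space_subprob_algebra sets_shifted_past_measure
             intro: prob_space_imp_subprob_space prob_space_shifted_past_measure)
  have "(\<integral>z. f z \<partial>averaged_past_measure g w k) =
      (\<integral>i. (\<integral>z. f z \<partial>shifted_past_measure g w i) \<partial>measure_pmf (pmf_of_set {..<k}))"
    unfolding averaged_past_measure_eq_bind[OF assms(1)]
    using prob_space.emeasure_space_1[OF prob_space_shifted_past_measure]
    by (intro integral_bind[OF _ _ M, where B' = 1 and B = c]) (use assms measure_pmf.finite_measure in auto)
  also have "\<dots> = (\<Sum>i<k. \<integral>z. f z \<partial>shifted_past_measure g w i) / real k"
    using assms by (subst integral_pmf_of_set) auto
  finally show ?thesis .
qed

end

section \<open>Envelopes and continuity\<close>

text \<open>The position \<open>k\<close> of a left-infinite sequence counts from the right end, so the constraint fixes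
  the \<open>n\<close> most recent symbols.\<close>

definition upper_envelope :: "('a left_seq \<Rightarrow> real) \<Rightarrow> nat \<Rightarrow> 'a left_seq \<Rightarrow> real" where
  "upper_envelope F n w = (SUP v\<in>{v. \<forall>k<n. v k = w k}. F v)"

definition lower_envelope :: "('a left_seq \<Rightarrow> real) \<Rightarrow> nat \<Rightarrow> 'a left_seq \<Rightarrow> real" where
  "lower_envelope F n w = (INF v\<in>{v. \<forall>k<n. v k = w k}. F v)"

locale unit_valued =
  fixes F :: "'a left_seq \<Rightarrow> real"
  assumes nonneg: "0 \<le> F w" and le_1: "F w \<le> 1"
begin

lemma bdd: "bdd_above (F ` S)" "bdd_below (F ` S)"
  using nonneg le_1 by (auto intro!: bdd_aboveI[of _ 1] bdd_belowI[of _ 0])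

lemma le_upper_envelope: "\<forall>k<n. v k = w k \<Longrightarrow> F v \<le> upper_envelope F n w"
  unfolding upper_envelope_def by (intro cSUP_upper bdd) simp

lemma lower_envelope_le: "\<forall>k<n. v k = w k \<Longrightarrow> lower_envelope F n w \<le> F v"
  unfolding lower_envelope_def by (intro cINF_lower bdd) simp

lemma upper_envelope_least: "(\<And>v. \<forall>k<n. v k = w k \<Longrightarrow> F v \<le> c) \<Longrightarrow> upper_envelope F n w \<le> c"
  unfolding upper_envelope_def by (rule cSUP_least) auto

lemma lower_envelope_greatest: "(\<And>v. \<forall>k<n. v k = w k \<Longrightarrow> c \<le> F v) \<Longrightarrow> c \<le> lower_envelope F n w"
  unfolding lower_envelope_def by (rule cINF_greatest) auto

lemma envelope_bounds:
  "0 \<le> upper_envelope F n w" "upper_envelope F n w \<le> 1"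
  "0 \<le> lower_envelope F n w" "lower_envelope F n w \<le> 1"
  using le_upper_envelope[of n w w] lower_envelope_le[of n w w] nonneg[of w] le_1[of w]
    upper_envelope_least[of n w 1] lower_envelope_greatest[of n w 0] nonneg le_1
  by fastforce+

lemma upper_envelope_antimono: "m \<le> n \<Longrightarrow> upper_envelope F n w \<le> upper_envelope F m w"
  by (intro upper_envelope_least le_upper_envelope) auto

lemma lower_envelope_mono: "m \<le> n \<Longrightarrow> lower_envelope F m w \<le> lower_envelope F n w"
  by (intro lower_envelope_greatest lower_envelope_le) auto

definition vanishing_oscillation :: "'a left_seq \<Rightarrow> bool" where
  "vanishing_oscillation w \<longleftrightarrow> (\<forall>m. \<exists>n. upper_envelope F n w - lower_envelope F n w < 1 / real (Suc m))"

lemma eventually_oscillation_less: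
  assumes "vanishing_oscillation w" "0 < e"
  obtains n where "\<And>k. n \<le> k \<Longrightarrow> upper_envelope F k w - lower_envelope F k w < e"
proof -
  obtain m where m: "1 / real (Suc m) < e" using nat_approx_posE[OF \<open>0 < e\<close>] by blast
  obtain n where "upper_envelope F n w - lower_envelope F n w < 1 / real (Suc m)"
    using assms by (auto simp: vanishing_oscillation_def)
  then show thesis
    using m upper_envelope_antimono[of n _ w] lower_envelope_mono[of n _ w]
    by (intro that[of n]) (smt (verit))
qed

lemma envelopes_tendsto:
  assumes "vanishing_oscillation w"
  shows "(\<lambda>n. upper_envelope F n w) \<longlonglongrightarrow> F w" "(\<lambda>n. lower_envelope F n w) \<longlonglongrightarrow> F w"
proof -
  have *: "lower_envelope F n w \<le> F w" "F w \<le> upper_envelope F n w" for n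
    using le_upper_envelope[of n w w] lower_envelope_le[of n w w] by auto
  have "\<exists>n. \<forall>k\<ge>n. norm (upper_envelope F k w - F w) < e \<and> norm (lower_envelope F k w - F w) < e"
    if e: "0 < e" for e
  proof -
    obtain n where n: "\<And>k. n \<le> k \<Longrightarrow> upper_envelope F k w - lower_envelope F k w < e"
      using eventually_oscillation_less[OF assms e] by blast
    have "norm (upper_envelope F k w - F w) < e \<and> norm (lower_envelope F k w - F w) < e" if "n \<le> k" for k
      using n[OF that] *[of k] by auto
    then show ?thesis by blast
  qed
  then show "(\<lambda>n. upper_envelope F n w) \<longlonglongrightarrow> F w" "(\<lambda>n. lower_envelope F n w) \<longlonglongrightarrow> F w"
    unfolding LIMSEQ_iff by blast+
qed

end

text \<open>Every neighbourhood in the product topology constrains only finitely many coordinates.\<close>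

lemma tendsto_if_prefixes_agree:
  fixes w :: "'a::topological_space left_seq"
  assumes "\<And>n. \<forall>k<n. ws n k = w k"
  shows "ws \<longlonglongrightarrow> w"
proof (rule topological_tendstoI)
  fix S :: "'a left_seq set" assume "open S" "w \<in> S"
  then obtain J where J: "finite J" "{y. \<forall>i\<in>J. y i = w i} \<subseteq> S"
    by (rule agreement_set_inside_open)
  obtain N where N: "\<forall>i\<in>J. i < N" using J(1) finite_nat_set_iff_bounded[of J] by auto
  have "ws n \<in> S" if "N \<le> n" for n
  proof -
    have "ws n i = w i" if "i \<in> J" for i
      using assms[of n] bspec[OF N that] \<open>N \<le> n\<close> by simp
    then show ?thesis using J(2) by blast
  qed
  then show "\<forall>\<^sub>F n in sequentially. ws n \<in> S" by (auto simp: eventually_sequentially)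
qed

text \<open>For a discrete alphabet the sequences that agree with \<open>w\<close> in their first \<open>n\<close> symbols form a
  neighbourhood base at \<open>w\<close>, so continuity at \<open>w\<close> says that the oscillation over these
  neighbourhoods vanishes. In this form, continuity is a countable combination of conditions on
  finitely many coordinates.\<close>

lemma sequentially_continuous_iff_vanishing_oscillation:
  fixes F :: "'a::discrete_topology left_seq \<Rightarrow> real"
  assumes "unit_valued F"
  shows "(\<forall>ws. ws \<longlonglongrightarrow> w \<longrightarrow> (\<lambda>k. F (ws k)) \<longlonglongrightarrow> F w) \<longleftrightarrow> unit_valued.vanishing_oscillation F w"
proof -
  interpret unit_valued F by fact
  show ?thesis
  proof
    assume small: "vanishing_oscillation w"
    have "(\<lambda>j. F (ws j)) \<longlonglongrightarrow> F w" if ws: "ws \<longlonglongrightarrow> w" for ws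
    proof (rule tendstoI)
      fix e :: real assume "0 < e"
      then obtain n where n: "upper_envelope F n w - lower_envelope F n w < e"
        using eventually_oscillation_less[OF small] by blast
      have "\<forall>\<^sub>F j in sequentially. ws j \<in> {v. \<forall>k\<in>{..<n}. v k = w k}"
        using ws open_agreement_set[of "{..<n}" w] by (rule topological_tendstoD) auto
      then show "\<forall>\<^sub>F j in sequentially. dist (F (ws j)) (F w) < e"
      proof eventually_elim
        case (elim j)
        then have "F (ws j) \<le> upper_envelope F n w" "lower_envelope F n w \<le> F (ws j)"
          by (auto intro: le_upper_envelope lower_envelope_le)
        then show ?case
          using n le_upper_envelope[of n w w] lower_envelope_le[of n w w] by (auto simp: dist_real_def)
      qed
    qed
    then show "\<forall>ws. ws \<longlonglongrightarrow> w \<longrightarrow> (\<lambda>k. F (ws k)) \<longlonglongrightarrow> F w" by blast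
  next
    assume cont: "\<forall>ws. ws \<longlonglongrightarrow> w \<longrightarrow> (\<lambda>k. F (ws k)) \<longlonglongrightarrow> F w"
    show "vanishing_oscillation w"
    proof (rule ccontr)
      assume "\<not> vanishing_oscillation w"
      then obtain m where m: "\<And>n. 1 / real (Suc m) \<le> upper_envelope F n w - lower_envelope F n w"
        unfolding vanishing_oscillation_def by (meson not_less)
      define e where "e = 1 / real (Suc m)"
      have "0 < e" by (simp add: e_def)
      \<comment> \<open>If all values were within \<open>e / 3\<close> of \<open>F w\<close>, the oscillation would be at most \<open>2 * e / 3 < e\<close>.\<close>
      have "\<exists>v. (\<forall>k<n. v k = w k) \<and> e / 3 \<le> \<bar>F v - F w\<bar>" for n
      proof (rule ccontr)
        assume *: "\<not> ?thesis"
        have close: "F v \<le> F w + e / 3" "F w - e / 3 \<le> F v" if "\<forall>k<n. v k = w k" for v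
        proof -
          have "\<bar>F v - F w\<bar> < e / 3" using * that by (meson not_less)
          then show "F v \<le> F w + e / 3" "F w - e / 3 \<le> F v" by linarith+
        qed
        have "upper_envelope F n w \<le> F w + e / 3" "F w - e / 3 \<le> lower_envelope F n w"
          by (rule upper_envelope_least[OF close(1)] lower_envelope_greatest[OF close(2)]; assumption)+
        then show False using m[of n] \<open>0 < e\<close> unfolding e_def[symmetric] by linarith
      qed
      then obtain ws where ws: "\<And>n. \<forall>k<n. ws n k = w k" "\<And>n. e / 3 \<le> \<bar>F (ws n) - F w\<bar>"
        by metis
      have "(\<lambda>n. F (ws n)) \<longlonglongrightarrow> F w" using cont tendsto_if_prefixes_agree[of ws w, OF ws(1)] by blast
      then have "\<forall>\<^sub>F n in sequentially. dist (F (ws n)) (F w) < e / 3"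
        using \<open>0 < e\<close> by (intro tendstoD) auto
      then obtain n where "dist (F (ws n)) (F w) < e / 3" by (auto simp: eventually_sequentially)
      then show False using ws(2)[of n] by (simp add: dist_real_def)
    qed
  qed
qed

lemma window_function_past:
  assumes "\<And>v w. \<forall>k<n. v k = w k \<Longrightarrow> H v = H w"
  shows "window_function n (\<lambda>z. H (past z))"
proof (rule window_functionI)
  fix y z :: "int \<Rightarrow> 'a" assume "\<And>i. \<bar>i\<bar> \<le> int n \<Longrightarrow> y i = z i"
  then show "H (past y) = H (past z)" by (intro assms) (auto simp: past_def)
qed

lemma window_function_mono:
  assumes "window_function m f" "m \<le> n"
  shows "window_function n f"
proof (rule window_functionI)
  fix y z :: "int \<Rightarrow> 'a" assume eq: "\<And>i. \<bar>i\<bar> \<le> int n \<Longrightarrow> y i = z i"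
  have "y i = z i" if "\<bar>i\<bar> \<le> int m" for i
    using that assms(2) by (intro eq) linarith
  then show "f y = f z" using assms(1) unfolding window_function_def by blast
qed

lemma window_function_compose2:
  assumes "window_function m f" "window_function n h"
  shows "window_function (max m n) (\<lambda>z. c (f z) (h z))"
proof (rule window_functionI)
  fix y z :: "int \<Rightarrow> 'a" assume eq: "\<And>i. \<bar>i\<bar> \<le> int (max m n) \<Longrightarrow> y i = z i"
  have "f y = f z" "h y = h z"
    using eq window_function_mono[OF assms(1), of "max m n"] window_function_mono[OF assms(2), of "max m n"]
    unfolding window_function_def by (meson max.cobounded1 max.cobounded2)+
  then show "c (f y) (h y) = c (f z) (h z)" by simp
qed

lemma window_function_envelopes:
  "window_function n (\<lambda>z. upper_envelope F n (past z))"
  "window_function n (\<lambda>z. lower_envelope F n (past z))"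
  by (rule window_function_past; simp add: upper_envelope_def lower_envelope_def)+

context g_kernel
begin

text \<open>The \<open>g\<close>-function with the symbol fixed, as a function of the past to which envelopes apply.\<close>

definition next_prob :: "'a \<Rightarrow> 'a left_seq \<Rightarrow> real" where
  "next_prob a w = g (snoc w a)"

lemma unit_valued_next_prob: "unit_valued (next_prob a)"
  by unfold_locales (simp_all add: next_prob_def g_nonneg g_le_1)

lemma measurable_next_prob_past: "(\<lambda>z. next_prob a (past z)) \<in> borel_measurable past_algebra"
  unfolding next_prob_def
  by (rule measurable_compose[OF measurable_past measurable_compose[OF measurable_snoc measurable_g]])

lemma measurable_next_prob_past' [measurable]: "(\<lambda>z. next_prob a (past z)) \<in> borel_measurable seq_algebra"
  using measurable_from_subalg[OF subalgebra_past_algebra[OF refl] measurable_next_prob_past] .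

lemma g_continuous_at_iff:
  "g_continuous_at g w \<longleftrightarrow> (\<forall>a. unit_valued.vanishing_oscillation (next_prob a) w)"
  unfolding g_continuous_at_def next_prob_def[symmetric]
  using sequentially_continuous_iff_vanishing_oscillation[OF unit_valued_next_prob] by blast

text \<open>The envelopes depend on finitely many coordinates and hence are measurable whatever \<open>g\<close> is;
  continuity is expressed through countably many of them.\<close>

lemma past_discontinuities_in_seq_algebra:
  "{y. past y \<in> discontinuities g} \<in> sets seq_algebra"
proof -
  note [measurable] = measurable_window_function[OF window_function_envelopes(1)]
    measurable_window_function[OF window_function_envelopes(2)]
  have "{y \<in> space seq_algebra. \<not> (\<forall>a::'a. \<forall>m. \<exists>n. upper_envelope (next_prob a) n (past y)
          - lower_envelope (next_prob a) n (past y) < 1 / real (Suc m))} \<in> sets seq_algebra"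
    by measurable
  then show ?thesis
    by (simp add: discontinuities_def g_continuous_at_iff
        unit_valued.vanishing_oscillation_def[OF unit_valued_next_prob])
qed

end

section \<open>Weak limits of the averages\<close>

lemma integrable_unit_interval:
  fixes f :: "(int \<Rightarrow> 'a) \<Rightarrow> real"
  assumes "prob_space M" "sets M = sets seq_algebra" "f \<in> borel_measurable seq_algebra"
    and "\<And>z. 0 \<le> f z \<and> f z \<le> 1"
  shows "integrable M f"
proof -
  interpret prob_space M by fact
  have "f \<in> borel_measurable M" using assms(3) measurable_cong_sets[OF assms(2) refl] by blast
  then show ?thesis using assms(4) by (intro integrable_const_bound[where B = 1]) auto
qed

context g_kernel
begin

lemma integral_averaged_past_measure_mono:
  assumes "0 < k" and f: "f \<in> borel_measurable seq_algebra" and h: "h \<in> borel_measurable seq_algebra"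
    and "\<And>z. 0 \<le> f z" "\<And>z. f z \<le> h z" "\<And>z. h z \<le> (1 :: real)"
  shows "(\<integral>z. f z \<partial>averaged_past_measure g w k) \<le> (\<integral>z. h z \<partial>averaged_past_measure g w k)"
proof -
  have bounds: "0 \<le> f z \<and> f z \<le> 1" "0 \<le> h z \<and> h z \<le> 1" for z
    using assms(4-6)[of z] by auto
  have "(\<integral>z. f z \<partial>shifted_past_measure g w i) \<le> (\<integral>z. h z \<partial>shifted_past_measure g w i)" for i
    by (intro integral_mono integrable_unit_interval[OF prob_space_shifted_past_measure sets_shifted_past_measure]
          f h bounds assms)
  then have "(\<Sum>i<k. \<integral>z. f z \<partial>shifted_past_measure g w i) / k \<le> (\<Sum>i<k. \<integral>z. h z \<partial>shifted_past_measure g w i) / k"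
    by (intro divide_right_mono sum_mono) auto
  moreover have abs: "\<bar>f z\<bar> \<le> 1" "\<bar>h z\<bar> \<le> 1" for z using bounds[of z] by auto
  ultimately show ?thesis
    by (simp only: integral_averaged_past_measure[OF assms(1) f abs(1)] integral_averaged_past_measure[OF assms(1) h abs(2)])
qed

lemma integral_averaged_one_step:
  assumes "0 < k" and p [measurable]: "p \<in> borel_measurable seq_algebra" and "\<And>u. 0 \<le> p u \<and> p u \<le> (1::real)"
  shows "(\<integral>z. p (past z) * indicator {z. z 0 = a} z \<partial>averaged_past_measure g w k) =
         (\<integral>z. p (past z) * next_prob a (past z) \<partial>averaged_past_measure g w k)"
proof -
  have [measurable]: "{z :: int \<Rightarrow> 'a. z 0 = a} \<in> sets seq_algebra"
  proof -
    have "{z \<in> space seq_algebra. z 0 = a} \<in> sets (seq_algebra :: (int \<Rightarrow> 'a) measure)" by measurable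
    then show ?thesis by simp
  qed
  have abs1: "\<bar>p (past z) * indicator {z. z 0 = a} z\<bar> \<le> 1" for z
    using assms(3)[of "past z"] by (auto simp: indicator_def)
  have abs2: "\<bar>p (past z) * next_prob a (past z)\<bar> \<le> 1" for z
    using assms(3)[of "past z"] g_nonneg g_le_1 by (auto simp: next_prob_def abs_mult intro!: mult_le_one)
  have meas: "(\<lambda>z. p (past z) * indicator {z. z 0 = a} z) \<in> borel_measurable seq_algebra"
    "(\<lambda>z. p (past z) * next_prob a (past z)) \<in> borel_measurable seq_algebra" by measurable
  show ?thesis
    using integral_one_step[OF p, where a = a and w = w] unfolding next_prob_def[symmetric]
    by (simp only: integral_averaged_past_measure[OF assms(1) meas(1) abs1]
        integral_averaged_past_measure[OF assms(1) meas(2) abs2])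
qed

end

locale subsequential_limit = g_kernel g for g :: "'a::{finite, discrete_topology} left_seq \<Rightarrow> real" +
  fixes x :: "'a left_seq" and \<mu> :: "(int \<Rightarrow> 'a) measure" and r :: "nat \<Rightarrow> nat"
  assumes prob_space_limit: "prob_space \<mu>"
    and sets_limit: "sets \<mu> = sets seq_algebra"
    and r: "strict_mono r" "1 \<le> r j"
    and limit: "weakly_converges (\<lambda>j. averaged_past_measure g x (r j)) \<mu>"
begin

sublocale prob_space \<mu> by (rule prob_space_limit)

lemmas [measurable_cong] = sets_limit

lemma space_limit [simp]: "space \<mu> = UNIV"
  using sets_eq_imp_space_eq[OF sets_limit] by simp

lemma r_pos: "0 < r j"
  using r(2)[of j] by simp

text \<open>The integrals of \<open>f \<circ> shift\<close> and \<open>f\<close> against the average over \<open>k\<close> shifts differ by a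
  telescoping sum, of which two boundary terms in \<open>[0, 1]\<close> remain, divided by \<open>k\<close>.\<close>

lemma integral_shift_invariant:
  fixes f :: "(int \<Rightarrow> 'a) \<Rightarrow> real"
  assumes f: "window_function n f" and unit: "\<And>z. 0 \<le> f z \<and> f z \<le> 1"
  shows "(\<integral>z. f (shift z) \<partial>\<mu>) = (\<integral>z. f z \<partial>\<mu>)"
proof -
  have fs: "window_function (Suc n) (\<lambda>z. f (shift z))"
    using f unfolding window_function_def shift_def by auto
  note meas = measurable_window_function[OF f] measurable_window_function[OF fs]
  define S where "S = (\<lambda>i. \<integral>z. f z \<partial>shifted_past_measure g x i)"
  have abs: "\<bar>f z\<bar> \<le> 1" for z using unit[of z] by auto
  have S: "0 \<le> S i \<and> S i \<le> 1" for i
  proof -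
    interpret S: prob_space "shifted_past_measure g x i" by (rule prob_space_shifted_past_measure)
    have "integrable (shifted_past_measure g x i) f"
      using unit by (intro integrable_unit_interval prob_space_shifted_past_measure sets_shifted_past_measure meas)
    then show ?thesis
      unfolding S_def using unit by (intro conjI integral_nonneg_AE S.integral_le_const) auto
  qed
  have step: "(\<integral>z. f (shift z) \<partial>shifted_past_measure g x i) = S (Suc i)" for i
  proof -
    have sets: "sets (past_measure g x) = sets seq_algebra"
      using starts_from_past_measure[of x] by (simp add: starts_from_def)
    note [measurable_cong] = sets
    note [measurable] = meas
    have "(\<integral>z. f (shift z) \<partial>shifted_past_measure g x i) = (\<integral>z. f (shift ((shift ^^ i) z)) \<partial>past_measure g x)"
      unfolding shifted_past_measure_def by (rule integral_distr) measurable
    moreover have "S (Suc i) = (\<integral>z. f ((shift ^^ Suc i) z) \<partial>past_measure g x)"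
      unfolding S_def shifted_past_measure_def by (rule integral_distr) measurable
    ultimately show ?thesis by simp
  qed
  have "(\<integral>z. f (shift z) \<partial>averaged_past_measure g x (r j)) - (\<integral>z. f z \<partial>averaged_past_measure g x (r j))
      = (S (r j) - S 0) / r j" for j
  proof -
    have "(\<Sum>i<r j. S (Suc i)) - (\<Sum>i<r j. S i) = S (r j) - S 0"
      by (simp add: sum_subtractf[symmetric] sum_lessThan_telescope)
    moreover have fold: "(\<integral>z. f z \<partial>shifted_past_measure g x i) = S i" for i by (simp add: S_def)
    ultimately show ?thesis
      by (simp add: integral_averaged_past_measure[OF r_pos meas(1) abs]
          integral_averaged_past_measure[OF r_pos meas(2) abs] step fold diff_divide_distrib[symmetric])
  qed
  moreover have "(\<lambda>j. (S (r j) - S 0) / r j) \<longlonglongrightarrow> 0"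
  proof (rule Lim_null_comparison)
    have "\<bar>S (r j) - S 0\<bar> / r j \<le> 1 / r j" for j
      using S[of "r j"] S[of 0] by (intro divide_right_mono) auto
    then show "\<forall>\<^sub>F j in sequentially. norm ((S (r j) - S 0) / r j) \<le> 1 / r j" by simp
    show "(\<lambda>j. 1 / r j) \<longlonglongrightarrow> 0"
      using LIMSEQ_subseq_LIMSEQ[OF lim_1_over_n r(1)] by (simp add: comp_def)
  qed
  ultimately have "(\<lambda>j. (\<integral>z. f (shift z) \<partial>averaged_past_measure g x (r j)) - (\<integral>z. f z \<partial>averaged_past_measure g x (r j))) \<longlonglongrightarrow> 0"
    by simp
  moreover have "(\<lambda>j. (\<integral>z. f (shift z) \<partial>averaged_past_measure g x (r j)) - (\<integral>z. f z \<partial>averaged_past_measure g x (r j)))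
      \<longlonglongrightarrow> (\<integral>z. f (shift z) \<partial>\<mu>) - (\<integral>z. f z \<partial>\<mu>)"
    by (intro tendsto_diff weak_limit_window_function[OF limit fs] weak_limit_window_function[OF limit f])
  ultimately show ?thesis using LIMSEQ_unique by fastforce
qed

lemma distr_shift_limit: "distr \<mu> seq_algebra shift = \<mu>"
proof (rule measure_eqI_window_boxes)
  have [measurable]: "shift \<in> \<mu> \<rightarrow>\<^sub>M seq_algebra"
    using measurable_shift measurable_cong_sets[OF sets_limit refl] by blast
  show "sets (distr \<mu> seq_algebra shift) = sigma_sets UNIV (coordinate_events UNIV)"
    "sets \<mu> = sigma_sets UNIV (coordinate_events UNIV)"
    by (simp_all add: sets_limit sets_seq_algebra)
  show "finite_measure (distr \<mu> seq_algebra shift)" by (rule finite_measure_distr) measurable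
  fix n and y :: "int \<Rightarrow> 'a"
  let ?B = "window_box UNIV n y"
  have B [measurable]: "?B \<in> sets seq_algebra" by (rule window_box_in_seq_algebra)
  have "measure \<mu> (shift -` ?B) = (\<integral>z. indicator ?B (shift z) \<partial>\<mu>)"
  proof -
    have "shift -` ?B \<inter> space \<mu> \<in> sets \<mu>" by measurable
    then have "(\<integral>z. indicator (shift -` ?B) z \<partial>\<mu>) = measure \<mu> (shift -` ?B)" by simp
    then show ?thesis by (simp add: indicator_def vimage_def)
  qed
  also have "\<dots> = (\<integral>z. indicator ?B z \<partial>\<mu>)"
    using window_function_window_box[of n of_bool UNIV y]
    by (intro integral_shift_invariant[of n]) (auto simp: indicator_def of_bool_def)
  also have "\<dots> = measure \<mu> ?B" by (simp add: sets_limit)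
  finally show "emeasure (distr \<mu> seq_algebra shift) ?B = emeasure \<mu> ?B"
    by (simp add: emeasure_distr emeasure_eq_measure)
qed

text \<open>The indicator \<open>p\<close> of the box and that of the symbol at \<open>0\<close> are window functions, hence so is
  their product, and its integrals converge. The product \<open>?G\<close> of \<open>p\<close> with the transition
  probability need not be continuous; it is squeezed between \<open>?L m\<close> and \<open>?U m\<close>, which are window
  functions, and the two bounds meet almost everywhere as \<open>m\<close> grows.\<close>

lemma compatible_on_window_box:
  assumes null: "emeasure \<mu> {y. past y \<in> discontinuities g} = 0"
  shows "(\<integral>z. indicator (window_box {..-1} n y) z * indicator {z. z 0 = a} z \<partial>\<mu>) =
    (\<integral>z. indicator (window_box {..-1} n y) z * next_prob a (past z) \<partial>\<mu>)"
proof -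
  interpret G: unit_valued "next_prob a" by (rule unit_valued_next_prob)
  define p :: "'a left_seq \<Rightarrow> real" where "p = indicator {w. \<forall>k<n. w k = past y k}"
  have box: "indicator (window_box {..-1} n y) z = p (past z)" for z
    unfolding p_def indicator_def window_box_past_iff ..
  have p01: "0 \<le> p u \<and> p u \<le> 1" for u by (simp add: p_def)
  have p_meas [measurable]: "p \<in> borel_measurable seq_algebra"
  proof -
    have "{w \<in> space seq_algebra. \<forall>k<n. w k = past y k} \<in> sets seq_algebra" by measurable
    then show ?thesis by (simp add: p_def)
  qed
  have p_window: "window_function n (\<lambda>z. p (past z))"
    by (rule window_function_past) (auto simp: p_def indicator_def)
  have a_window: "window_function 0 (\<lambda>z. indicator {z :: int \<Rightarrow> 'a. z 0 = a} z :: real)"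
    by (rule window_functionI) (auto simp: indicator_def)
  let ?U = "\<lambda>m z. p (past z) * upper_envelope (next_prob a) m (past z)"
  let ?L = "\<lambda>m z. p (past z) * lower_envelope (next_prob a) m (past z)"
  let ?G = "\<lambda>z. p (past z) * next_prob a (past z)"
  let ?A = "\<lambda>z. p (past z) * indicator {z. z 0 = a} z"
  let ?\<nu> = "\<lambda>j. averaged_past_measure g x (r j)"
  note windows = window_function_compose2[OF p_window window_function_envelopes(1), where c = "(*)"]
    window_function_compose2[OF p_window window_function_envelopes(2), where c = "(*)"]
    window_function_compose2[OF p_window a_window, where c = "(*)"]
  note [measurable] = measurable_window_function[OF window_function_envelopes(1)]
    measurable_window_function[OF window_function_envelopes(2)]
  have G_meas [measurable]: "?G \<in> borel_measurable seq_algebra" by measurable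
  have meas: "?G \<in> borel_measurable \<mu>" "?U m \<in> borel_measurable \<mu>" "?L m \<in> borel_measurable \<mu>" for m
    using G_meas measurable_window_function[OF windows(1)] measurable_window_function[OF windows(2)]
    by (simp_all add: measurable_cong_sets[OF sets_limit refl])
  have order: "0 \<le> ?L m z" "?L m z \<le> ?G z" "?G z \<le> ?U m z" "?U m z \<le> 1" "0 \<le> ?G z" "?G z \<le> 1" for m z
    using p01[of "past z"] G.envelope_bounds[of m "past z"] G.nonneg[of "past z"] G.le_1[of "past z"]
      G.le_upper_envelope[of m "past z" "past z"] G.lower_envelope_le[of m "past z" "past z"]
    by (auto intro!: mult_left_mono mult_le_one)
  have norm_le: "norm (?U m z) \<le> 1" "norm (?L m z) \<le> 1" for m z
  proof -
    have "0 \<le> ?L m z" "?L m z \<le> ?G z" "?G z \<le> ?U m z" "?U m z \<le> 1" by (rule order)+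
    then show "norm (?U m z) \<le> 1" "norm (?L m z) \<le> 1" unfolding real_norm_def by linarith+
  qed
  \<comment> \<open>Averages satisfy the compatibility relation exactly, which turns the pointwise bounds on \<open>?G\<close>
    into bounds on \<open>?A\<close>; only window functions remain when passing to the limit in \<open>j\<close>.\<close>
  have sandwich: "(\<integral>z. ?L m z \<partial>\<mu>) \<le> (\<integral>z. ?A z \<partial>\<mu>)" "(\<integral>z. ?A z \<partial>\<mu>) \<le> (\<integral>z. ?U m z \<partial>\<mu>)" for m
  proof -
    have one_step: "(\<integral>z. ?A z \<partial>?\<nu> j) = (\<integral>z. ?G z \<partial>?\<nu> j)" for j
      by (rule integral_averaged_one_step[OF r_pos p_meas p01])
    have "(\<integral>z. ?L m z \<partial>?\<nu> j) \<le> (\<integral>z. ?A z \<partial>?\<nu> j)" for j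
      unfolding one_step by (rule integral_averaged_past_measure_mono[OF r_pos]) (measurable, auto simp: order)
    then show "(\<integral>z. ?L m z \<partial>\<mu>) \<le> (\<integral>z. ?A z \<partial>\<mu>)"
      by (intro LIMSEQ_le[OF weak_limit_window_function[OF limit windows(2)] weak_limit_window_function[OF limit windows(3)]]) blast
    have "(\<integral>z. ?A z \<partial>?\<nu> j) \<le> (\<integral>z. ?U m z \<partial>?\<nu> j)" for j
      unfolding one_step by (rule integral_averaged_past_measure_mono[OF r_pos]) (measurable, auto simp: order)
    then show "(\<integral>z. ?A z \<partial>\<mu>) \<le> (\<integral>z. ?U m z \<partial>\<mu>)"
      by (intro LIMSEQ_le[OF weak_limit_window_function[OF limit windows(3)] weak_limit_window_function[OF limit windows(1)]]) blast
  qed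
  have "AE z in \<mu>. past z \<notin> discontinuities g"
    using null past_discontinuities_in_seq_algebra by (intro AE_I[where N = "{y. past y \<in> discontinuities g}"]) (auto simp: sets_limit)
  then have small: "AE z in \<mu>. G.vanishing_oscillation (past z)"
    by (auto simp: discontinuities_def g_continuous_at_iff)
  have "(\<lambda>m. \<integral>z. ?U m z \<partial>\<mu>) \<longlonglongrightarrow> (\<integral>z. ?G z \<partial>\<mu>)"
  proof (rule integral_dominated_convergence[where w = "\<lambda>_. 1"])
    show "AE z in \<mu>. (\<lambda>m. ?U m z) \<longlonglongrightarrow> ?G z"
      using small by eventually_elim (intro tendsto_intros G.envelopes_tendsto)
    show "AE z in \<mu>. norm (?U m z) \<le> 1" for m
      by (intro AE_I2 norm_le)
  qed (simp_all add: meas)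
  then have "(\<integral>z. ?A z \<partial>\<mu>) \<le> (\<integral>z. ?G z \<partial>\<mu>)"
    by (rule LIMSEQ_le_const) (use sandwich in blast)
  moreover have "(\<lambda>m. \<integral>z. ?L m z \<partial>\<mu>) \<longlonglongrightarrow> (\<integral>z. ?G z \<partial>\<mu>)"
  proof (rule integral_dominated_convergence[where w = "\<lambda>_. 1"])
    show "AE z in \<mu>. (\<lambda>m. ?L m z) \<longlonglongrightarrow> ?G z"
      using small by eventually_elim (intro tendsto_intros G.envelopes_tendsto)
    show "AE z in \<mu>. norm (?L m z) \<le> 1" for m
      by (intro AE_I2 norm_le)
  qed (simp_all add: meas)
  then have "(\<integral>z. ?G z \<partial>\<mu>) \<le> (\<integral>z. ?A z \<partial>\<mu>)"
    by (rule LIMSEQ_le_const2) (use sandwich in blast)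
  ultimately show ?thesis by (simp add: box)
qed

lemma emeasure_density_unit:
  assumes f: "f \<in> borel_measurable seq_algebra" and unit: "\<And>z. 0 \<le> f z \<and> f z \<le> 1" and A: "A \<in> sets \<mu>"
  shows "emeasure (density \<mu> (\<lambda>z. ennreal (f z))) A = ennreal (\<integral>z. indicator A z * f z \<partial>\<mu>)"
proof -
  have [measurable]: "f \<in> borel_measurable \<mu>" using f measurable_cong_sets[OF sets_limit refl] by blast
  note [measurable] = A
  have "emeasure (density \<mu> (\<lambda>z. ennreal (f z))) A = (\<integral>\<^sup>+z. ennreal (indicator A z * f z) \<partial>\<mu>)"
    by (subst emeasure_density) (auto intro!: nn_integral_cong simp: indicator_def)
  also have "\<dots> = ennreal (\<integral>z. indicator A z * f z \<partial>\<mu>)"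
    using unit by (intro nn_integral_eq_integral integrable_const_bound[where B = 1]) (auto simp: indicator_def)
  finally show ?thesis .
qed

text \<open>Weighting the limit measure by the indicator of the symbol \<open>a\<close> and by its transition probability
  gives two finite measures on the past \<open>\<sigma>\<close>-algebra. They agree on boxes, hence everywhere, which is
  the defining property of the conditional expectation.\<close>

lemma compatible_limit:
  assumes null: "emeasure \<mu> {y. past y \<in> discontinuities g} = 0"
  shows "compatible g \<mu>"
proof -
  have sub: "subalgebra \<mu> past_algebra" by (rule subalgebra_past_algebra[OF sets_limit])
  interpret finite_measure_subalgebra \<mu> past_algebra by unfold_locales (rule sub)
  have "AE z in \<mu>. real_cond_exp \<mu> past_algebra (indicator {y. y 0 = a}) z = next_prob a (past z)" for a
  proof (rule real_cond_exp_charact)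
    let ?f = "indicator {z :: int \<Rightarrow> 'a. z 0 = a} :: _ \<Rightarrow> real" and ?h = "\<lambda>z. next_prob a (past z)"
    have f: "?f \<in> borel_measurable seq_algebra"
    proof -
      have "{z \<in> space seq_algebra. z 0 = a} \<in> sets (seq_algebra :: (int \<Rightarrow> 'a) measure)" by measurable
      then show ?thesis by simp
    qed
    have h: "?h \<in> borel_measurable seq_algebra" by measurable
    have unit: "0 \<le> ?f z \<and> ?f z \<le> 1" "0 \<le> ?h z \<and> ?h z \<le> 1" for z
      by (simp_all add: next_prob_def g_nonneg g_le_1)
    show int: "integrable \<mu> ?f" "integrable \<mu> ?h"
      by (intro integrable_unit_interval prob_space_limit sets_limit f h unit)+
    show "?h \<in> borel_measurable past_algebra" by (rule measurable_next_prob_past)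
    let ?M = "\<lambda>f. restr_to_subalg (density \<mu> (\<lambda>z. ennreal (f z))) past_algebra"
    have sub_density: "subalgebra (density \<mu> q) past_algebra" for q
      using sub by (simp add: subalgebra_def)
    have eval: "emeasure (?M q) A = ennreal (\<integral>z. indicator A z * q z \<partial>\<mu>)"
      if "q \<in> borel_measurable seq_algebra" "\<And>z. 0 \<le> q z \<and> q z \<le> 1" "A \<in> sets past_algebra" for q A
      using that sub by (auto simp: emeasure_restr_to_subalg[OF sub_density] subalgebra_def intro!: emeasure_density_unit)
    have "?M ?f = ?M ?h"
    proof (rule measure_eqI_window_boxes)
      show "sets (?M ?f) = sigma_sets UNIV (coordinate_events {..-1})"
        "sets (?M ?h) = sigma_sets UNIV (coordinate_events {..-1})"
        by (simp_all add: sets_restr_to_subalg[OF sub_density] sets_past_algebra)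
      have "emeasure (?M ?f) UNIV \<noteq> \<infinity>"
        using sets.top[of past_algebra] by (subst eval[OF f unit(1)]) auto
      then show "finite_measure (?M ?f)"
        by (intro finite_measureI) (simp add: space_restr_to_subalg)
      show "emeasure (?M ?f) (window_box {..-1} n y) = emeasure (?M ?h) (window_box {..-1} n y)" for n y
        by (simp only: eval[OF f unit(1) window_box_in_past_algebra] eval[OF h unit(2) window_box_in_past_algebra]
            compatible_on_window_box[OF null])
    qed
    then have eq: "ennreal (\<integral>z. indicator A z * ?f z \<partial>\<mu>) = ennreal (\<integral>z. indicator A z * ?h z \<partial>\<mu>)"
      if "A \<in> sets past_algebra" for A
      using eval[OF f unit(1) that] eval[OF h unit(2) that] by simp
    fix A :: "(int \<Rightarrow> 'a) set" assume A: "A \<in> sets past_algebra"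
    have "(\<integral>z. indicator A z * ?f z \<partial>\<mu>) = (\<integral>z. indicator A z * ?h z \<partial>\<mu>)"
      using eq[OF A] unit by (subst (asm) ennreal_inj) (auto intro!: integral_nonneg_AE)
    then show "(\<integral>z\<in>A. ?f z \<partial>\<mu>) = (\<integral>z\<in>A. ?h z \<partial>\<mu>)"
      by (simp add: set_lebesgue_integral_def)
  qed
  then show ?thesis by (simp add: compatible_def next_prob_def)
qed

end

theorem theorem1:
  fixes g :: "'a::{finite, discrete_topology} left_seq \<Rightarrow> real"
    and x :: "'a left_seq"
    and \<mu> :: "(int \<Rightarrow> 'a) measure"
  assumes "g_function g"
    and "subsequential_weak_limit (averaged_past_measure g x) \<mu>"
    and "emeasure \<mu> {y. past y \<in> discontinuities g} = 0"
  shows "\<mu> \<in> invariant_g_measures g \<and> invariant_g_measures g \<noteq> {}"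
proof -
  obtain r where r: "prob_space \<mu>" "sets \<mu> = sets seq_algebra" "strict_mono r" "\<And>j. 1 \<le> r j"
      "weakly_converges (\<lambda>j. averaged_past_measure g x (r j)) \<mu>"
    using assms(2) unfolding subsequential_weak_limit_def by blast
  interpret subsequential_limit g x \<mu> r
    by (intro subsequential_limit.intro subsequential_limit_axioms.intro g_kernel.intro assms(1) r)
  have "\<mu> \<in> invariant_g_measures g"
    using prob_space_limit sets_limit distr_shift_limit compatible_limit[OF assms(3)]
    by (simp add: invariant_g_measures_def)
  then show ?thesis by blast
qed

end
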